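(* Let $\|\cdot\|$ be a norm on $\mathbb{R}^d$ with associated sequence $\{\|\cdot\|^{\mathrm{tn}}_{\star,(j)}\}_{j\in\{1,\ldots,d\}}$ of generalized top-$k$ dual norms, sequence $\{\|\cdot\|^{\star\mathrm{sn}}_{\star,(j)}\}_{j\in\{1,\ldots,d\}}$ of generalized $k$-support dual norms, and associated Capra coupling ¢. Suppose that both the norm $\|\cdot\|$ and the dual norm $\|\cdot\|_\star$ are orthant-strictly monotonic. Let $\varphi:\{0,1,\ldots,d\}\to\mathbb{R}_+$ be a nonnegative nondecreasing function such that $\varphi(0)=0$. Define the function $\mathcal{L}_0^\varphi:\mathbb{R}^d\to\overline{\mathbb{R}}$ by $$\mathcal{L}_0^\varphi=\big((\varphi\circ\ell_0)^{¢}\big)^{\star'}.$$ Then the following statements hold true. (a) The function $\mathcal{L}_0^\varphi$ is proper convex lower semicontinuous (lsc). (b) $\varphi\circ\ell_0$ coincides with $\mathcal{L}_0^\varphi$ on the unit sphere $S=\{x\in\mathbb{R}^d:\|x\|=1\}$: $(\varphi\circ\ell_0)(s)=\mathcal{L}_0^\varphi(s)$ for all $s\in S$. (c) The Capra-subdifferential of $\varphi\circ\ell_0$ coincides, on $S$, with the Rockafellar–Moreau subdifferential of $\mathcal{L}_0^\varphi$: $\partial_{¢}(\varphi\circ\ell_0)(s)=\partial\mathcal{L}_0^\varphi(s)$ for all $s\in S$. (d) (Convex factorization) $\varphi\circ\ell_0=\mathcal{L}_0^\varphi\circ n$, where $n$ is the normalization mapping; or, equivalently, $(\varphi\circ\ell_0)(x)=\mathcal{L}_0^\varphi\big(x/\|x\|\big)$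 for all $x\in\mathbb{R}^d\setminus\{0\}$. (e) $\mathcal{L}_0^\varphi=\Big(\sup_{j\in\{0,\ldots,d\}}\big[\|\cdot\|^{\mathrm{tn}}_{\star,(j)}-\varphi(j)\big]\Big)^{\star'}$. (f) $\mathcal{L}_0^\varphi$ is the largest convex lsc function below the function $x\in\mathbb{R}^d\mapsto\inf_{j\in\{0,\ldots,d\}}\big[\delta_{B^{\star\mathrm{sn}}_{\star,(j)}}(x)+\varphi(j)\big]$, that is, below the function taking the value $\varphi(j)$ for $x\in B^{\star\mathrm{sn}}_{\star,(j)}\setminus B^{\star\mathrm{sn}}_{\star,(j-1)}$, $j\in\{1,\ldots,d\}$, the value $0$ for $x\in B^{\star\mathrm{sn}}_{\star,(0)}=\{0\}$, and $+\infty$ outside $B^{\star\mathrm{sn}}_{\star,(d)}=B$ (this makes sense as $B^{\star\mathrm{sn}}_{\star,(1)}\subset\cdots\subset B^{\star\mathrm{sn}}_{\star,(j-1)}\subset B^{\star\mathrm{sn}}_{\star,(j)}\subset\cdots\subset B^{\star\mathrm{sn}}_{\star,(d)}=B$). (g) $\mathcal{L}_0^\varphi$ is the largest convex lsc function below the function $x\in\mathbb{R}^d\mapsto\inf_{j\in\{0,\ldots,d\}}\big[\delta_{S^{\star\mathrm{sn}}_{\star,(j)}}(x)+\varphi(j)\big]$, that is, below the function $x\mapsto\inf\{\varphi(j): j\in\{0,\ldots,d\},\ x\in S^{\star\mathrm{sn}}_{\star,(j)}\}$, with the conventions $S^{\star\mathrm{sn}}_{\star,(0)}=\{0\}$ and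 $\inf\emptyset=+\infty$. (h) The proper convex lsc function $\mathcal{L}_0^\varphi$ also has the following three variational expressions, for all $x\in\mathbb{R}^d$, where $\Delta_{d+1}$ is the simplex of $\mathbb{R}^{d+1}$: $$\mathcal{L}_0^\varphi(x)=\min_{\substack{(\lambda_0,\lambda_1,\ldots,\lambda_d)\in\Delta_{d+1}\\ x\in\sum_{j=1}^d\lambda_jB^{\star\mathrm{sn}}_{\star,(j)}}}\ \sum_{j=1}^d\lambda_j\varphi(j) =\min_{\substack{(\lambda_0,\lambda_1,\ldots,\lambda_d)\in\Delta_{d+1}\\ x\in\sum_{j=1}^d\lambda_jS^{\star\mathrm{sn}}_{\star,(j)}}}\ \sum_{j=1}^d\lambda_j\varphi(j)$$ $$=\min_{\substack{x^{(1)}\in\mathbb{R}^d,\ldots,x^{(d)}\in\mathbb{R}^d\\ \sum_{j=1}^d\|x^{(j)}\|^{\star\mathrm{sn}}_{\star,(j)}\le1\\ \sum_{j=1}^dx^{(j)}=x}}\ \sum_{j=1}^d\varphi(j)\,\|x^{(j)}\|^{\star\mathrm{sn}}_{\star,(j)}.$$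
   Context: $\mathbb{R}^d$ ($d\ge1$) is equipped with the scalar product $\langle\cdot,\cdot\rangle$ (the source norm $\|\cdot\|$ need not be Euclidean); $B=\{x:\|x\|\le1\}$ and $S=\{x:\|x\|=1\}$. $\ell_0(x)$ is the number of nonzero components of $x\in\mathbb{R}^d$. The dual norm is $\|y\|_\star=\sup_{\|x\|\le1}\langle x,y\rangle$. The normalization mapping is $n(x)=x/\|x\|$ if $x\ne0$, $n(0)=0$. $\overline{\mathbb{R}}=[-\infty,+\infty]$. $\delta_A$ is the characteristic function of $A$: $0$ on $A$, $+\infty$ outside. $\Delta_{d+1}$ is the set of vectors in $\mathbb{R}^{d+1}$ with nonnegative entries summing to $1$. Sums of sets are Minkowski sums, and an infimum (minimum) over an empty set is $+\infty$. A norm $N$ on $\mathbb{R}^d$ is orthant-strictly monotonic if, for all $x,x'\in\mathbb{R}^d$ with $|x_i|\le|x'_i|$ for all $i$, $|x_j|<|x'_j|$ for some $j$, and $x_ix'_i\ge0$ for all $i$, one has $N(x)<N(x')$. Generalized top-$k$ dual norm: for $k\in\{1,\ldots,d\}$, $\|y\|^{\mathrm{tn}}_{\star,(k)}=\sup_{K\subset\{1,\ldots,d\},\,|K|\le k}\|y_K\|_\star$, where $y_K$ coincides with $y$ on $K$ and vanishes outside $K$; convention $\|\cdot\|^{\mathrm{tn}}_{\star,(0)}=0$. The generalized $k$-support dual norm $\|\cdot\|^{\star\mathrm{sn}}_{\star,(k)}$ is the dual norm of $\|\cdot\|^{\mathrm{tn}}_{\star,(k)}$; its closed unit ball is $B^{\star\mathrm{sn}}_{\star,(k)}$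 and its unit sphere is $S^{\star\mathrm{sn}}_{\star,(k)}$; conventions $B^{\star\mathrm{sn}}_{\star,(0)}=S^{\star\mathrm{sn}}_{\star,(0)}=\{0\}$. Capra coupling: ¢$(x,y)=\langle x,y\rangle/\|x\|$ if $x\neq0$, and ¢$(0,y)=0$. The Moreau lower addition $\dot{+}$ extends the usual addition to $\overline{\mathbb{R}}$ with $(+\infty)\dot{+}(-\infty)=(-\infty)\dot{+}(+\infty)=-\infty$. For $f:\mathbb{R}^d\to\overline{\mathbb{R}}$: $f^{¢}(y)=\sup_{x\in\mathbb{R}^d}(¢(x,y)\dot{+}(-f(x)))$; the Capra-subdifferential is $\partial_{¢}f(x)=\{y: f^{¢}(y)=¢(x,y)\dot{+}(-f(x))\}$; the Fenchel conjugate is $f^\star(y)=\sup_{x\in\mathbb{R}^d}(\langle x,y\rangle\dot{+}(-f(x)))$; the Rockafellar–Moreau subdifferential is $\partial f(x)=\{y: f^\star(y)=\langle x,y\rangle\dot{+}(-f(x))\}$. For $g:\mathbb{R}^d\to\overline{\mathbb{R}}$, the reverse Fenchel conjugate is $g^{\star'}(x)=\sup_{y\in\mathbb{R}^d}(\langle x,y\rangle\dot{+}(-g(y)))$. A function is proper if it never takes the value $-\infty$ and is not identically $+\infty$. *)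

theory Defs
  imports "HOL-Analysis.Analysis"
begin

section \<open>Extended-real-valued functions\<close>

text \<open>The addition of type \<^typ>\<open>ereal\<close> is the Moreau \<^emph>\<open>upper\<close> addition
  (\<open>\<infinity> + -\<infinity> = \<infinity>\<close>), so the lower addition is defined here.\<close>

definition lower_add :: "ereal \<Rightarrow> ereal \<Rightarrow> ereal"  (infixl \<open>\<plusdot>\<close> 65)
  where "a \<plusdot> b = (if a = -\<infinity> \<or> b = -\<infinity> then -\<infinity> else a + b)"

definition char_fun :: "'a set \<Rightarrow> 'a \<Rightarrow> ereal"
  where "char_fun A x = (if x \<in> A then 0 else \<infinity>)"

definition proper_fun :: "('a \<Rightarrow> ereal) \<Rightarrow> bool"
  where "proper_fun f \<longleftrightarrow> (\<forall>x. f x \<noteq> -\<infinity>) \<and> (\<exists>x. f x \<noteq> \<infinity>)"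

text \<open>The library's \<^const>\<open>convex_on\<close> and \<^const>\<open>epigraph\<close> only cover real-valued functions.\<close>

definition convex_fun :: "('a::real_vector \<Rightarrow> ereal) \<Rightarrow> bool"
  where "convex_fun f \<longleftrightarrow> convex {(x, t::real). f x \<le> ereal t}"

definition lsc_fun :: "('a::topological_space \<Rightarrow> ereal) \<Rightarrow> bool"
  where "lsc_fun f \<longleftrightarrow> (\<forall>x. f x \<le> Liminf (at x) f)"

definition largest_convex_lsc_below :: "('a::real_normed_vector \<Rightarrow> ereal) \<Rightarrow> ('a \<Rightarrow> ereal) \<Rightarrow> bool"
  where "largest_convex_lsc_below f g \<longleftrightarrow>
    convex_fun f \<and> lsc_fun f \<and> f \<le> g \<and>
    (\<forall>h. convex_fun h \<and> lsc_fun h \<and> h \<le> g \<longrightarrow> h \<le> f)"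

text \<open>\<open>v\<close> is the minimum of \<open>A\<close>: the infimum is attained, except that the minimum
  of the empty set is \<open>\<infinity>\<close>.\<close>

definition is_minimum :: "ereal \<Rightarrow> ereal set \<Rightarrow> bool"
  where "is_minimum v A \<longleftrightarrow> v = Inf A \<and> (A \<noteq> {} \<longrightarrow> v \<in> A)"


section \<open>Conjugacies and subdifferentials\<close>

definition conj_fun :: "('a \<Rightarrow> 'b \<Rightarrow> real) \<Rightarrow> ('a \<Rightarrow> ereal) \<Rightarrow> 'b \<Rightarrow> ereal"
  where "conj_fun c f y = (SUP x. ereal (c x y) \<plusdot> (- f x))"

definition subdiff :: "('a \<Rightarrow> 'b \<Rightarrow> real) \<Rightarrow> ('a \<Rightarrow> ereal) \<Rightarrow> 'a \<Rightarrow> 'b set"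
  where "subdiff c f x = {y. conj_fun c f y = ereal (c x y) \<plusdot> (- f x)}"

abbreviation fenchel_subdiff :: "('a::real_inner \<Rightarrow> ereal) \<Rightarrow> 'a \<Rightarrow> 'a set"
  where "fenchel_subdiff \<equiv> subdiff (\<lambda>x y. x \<bullet> y)"

abbreviation reverse_fenchel_conj :: "('a::real_inner \<Rightarrow> ereal) \<Rightarrow> 'a \<Rightarrow> ereal"
  where "reverse_fenchel_conj \<equiv> conj_fun (\<lambda>y x. x \<bullet> y)"

definition capra_coupling :: "('a::real_inner \<Rightarrow> real) \<Rightarrow> 'a \<Rightarrow> 'a \<Rightarrow> real"
  where "capra_coupling N x y = (if x = 0 then 0 else (x \<bullet> y) / N x)"

abbreviation capra_conj :: "('a::real_inner \<Rightarrow> real) \<Rightarrow> ('a \<Rightarrow> ereal) \<Rightarrow> 'a \<Rightarrow> ereal"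
  where "capra_conj N \<equiv> conj_fun (capra_coupling N)"

abbreviation capra_subdiff :: "('a::real_inner \<Rightarrow> real) \<Rightarrow> ('a \<Rightarrow> ereal) \<Rightarrow> 'a \<Rightarrow> 'a set"
  where "capra_subdiff N \<equiv> subdiff (capra_coupling N)"


section \<open>Norms\<close>

text \<open>The library's \<^const>\<open>norm\<close> on \<^typ>\<open>real^'n\<close> is the Euclidean one, so an arbitrary
  norm is a function satisfying the norm axioms.\<close>

definition is_norm :: "('a::real_vector \<Rightarrow> real) \<Rightarrow> bool"
  where "is_norm N \<longleftrightarrow>
    (\<forall>x. N x = 0 \<longleftrightarrow> x = 0) \<and>
    (\<forall>c x. N (c *\<^sub>R x) = \<bar>c\<bar> * N x) \<and>
    (\<forall>x y. N (x + y) \<le> N x + N y)"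

text \<open>The real supremum is meaningful when \<open>N\<close> is a norm on a finite-dimensional space,
  since then the set of values is bounded above.\<close>

definition dual_norm :: "('a::real_inner \<Rightarrow> real) \<Rightarrow> 'a \<Rightarrow> real"
  where "dual_norm N y = (SUP x\<in>{x. N x \<le> 1}. x \<bullet> y)"

definition normalize_by :: "('a::real_vector \<Rightarrow> real) \<Rightarrow> 'a \<Rightarrow> 'a"
  where "normalize_by N x = (if x = 0 then 0 else (1 / N x) *\<^sub>R x)"

definition orthant_strictly_monotonic :: "(real^'n \<Rightarrow> real) \<Rightarrow> bool"
  where "orthant_strictly_monotonic N \<longleftrightarrow>
    (\<forall>x x'. (\<forall>i. \<bar>x $ i\<bar> \<le> \<bar>x' $ i\<bar>) \<and> (\<exists>j. \<bar>x $ j\<bar> < \<bar>x' $ j\<bar>) \<and> (\<forall>i. x $ i * x' $ i \<ge> 0)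
      \<longrightarrow> N x < N x')"

definition restrict_vec :: "'n set \<Rightarrow> real^'n \<Rightarrow> real^'n"
  where "restrict_vec K y = (\<chi> i. if i \<in> K then y $ i else 0)"

definition top_dual_norm :: "(real^'n \<Rightarrow> real) \<Rightarrow> nat \<Rightarrow> real^'n \<Rightarrow> real"
  where "top_dual_norm N k y =
    (if k = 0 then 0 else (SUP K\<in>{K. card K \<le> k}. dual_norm N (restrict_vec K y)))"

text \<open>The support dual norm is only meaningful for \<open>k \<ge> 1\<close>; balls and spheres of index \<open>0\<close>
  follow a separate convention.\<close>

definition support_dual_norm :: "(real^'n \<Rightarrow> real) \<Rightarrow> nat \<Rightarrow> real^'n \<Rightarrow> real"
  where "support_dual_norm N k = dual_norm (top_dual_norm N k)"

definition support_ball :: "(real^'n \<Rightarrow> real) \<Rightarrow> nat \<Rightarrow> (real^'n) set"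
  where "support_ball N k = (if k = 0 then {0} else {x. support_dual_norm N k x \<le> 1})"

definition support_sphere :: "(real^'n \<Rightarrow> real) \<Rightarrow> nat \<Rightarrow> (real^'n) set"
  where "support_sphere N k = (if k = 0 then {0} else {x. support_dual_norm N k x = 1})"


section \<open>Functions of the \<open>\<ell>\<^sub>0\<close> pseudonorm\<close>

definition l0 :: "real^'n \<Rightarrow> nat"
  where "l0 x = card {i. x $ i \<noteq> 0}"

text \<open>Only the values of \<open>\<phi>\<close> on \<open>{0..CARD('n)}\<close> matter below.\<close>

definition L0 :: "(real^'n \<Rightarrow> real) \<Rightarrow> (nat \<Rightarrow> real) \<Rightarrow> real^'n \<Rightarrow> ereal"
  where "L0 N \<phi> = reverse_fenchel_conj (capra_conj N (ereal \<circ> \<phi> \<circ> l0))"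

definition inf_char_fun :: "(nat \<Rightarrow> (real^'n) set) \<Rightarrow> (nat \<Rightarrow> real) \<Rightarrow> real^'n \<Rightarrow> ereal"
  where "inf_char_fun A \<phi> x = (INF j\<in>{0..CARD('n)}. char_fun (A j) x + ereal (\<phi> j))"

text \<open>\<open>prob_simplex d\<close> is the simplex of \<open>\<real>\<^bsup>d+1\<^esup>\<close>, with coordinates indexed by \<open>0, \<dots>, d\<close>.\<close>

definition prob_simplex :: "nat \<Rightarrow> (nat \<Rightarrow> real) set"
  where "prob_simplex d = {w \<in> {0..d} \<rightarrow>\<^sub>E {0..}. (\<Sum>j=0..d. w j) = 1}"

text \<open>\<open>weighted_sum w A d\<close> is the Minkowski sum \<open>w\<^sub>1A\<^sub>1 + \<dots> + w\<^sub>dA\<^sub>d\<close>.\<close>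

definition weighted_sum :: "(nat \<Rightarrow> real) \<Rightarrow> (nat \<Rightarrow> 'a::real_vector set) \<Rightarrow> nat \<Rightarrow> 'a set"
  where "weighted_sum w A d = (\<Sum>j=1..d. (*\<^sub>R) (w j) ` A j)"

end

theory Submission
  imports Defs
begin

text \<open>
Write \<open>d\<close> for the dimension, \<open>top\<^sub>j\<close> for the top-\<open>j\<close> dual norm and \<open>B\<^sub>j\<close> for the unit ball of its
dual norm, the \<open>j\<close>-support dual norm. By bipolarity (\<open>dual_dual_norm\<close>), \<open>top\<^sub>j\<close> is the support
function of \<open>B\<^sub>j\<close>.

The Capra conjugate of \<open>\<phi> \<circ> \<ell>\<^sub>0\<close> is a supremum over the unit sphere and the origin, which can be sorted by the number
of nonzero entries. Orthant monotonicity of the source norm says that deleting entries does not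
increase the norm, so the supremum of \<open>x \<bullet> y\<close> over unit vectors with at most \<open>j\<close> nonzero entries is
\<open>top\<^sub>j y\<close>. Hence the Capra conjugate is \<open>g y = max\<^sub>j (top\<^sub>j y - \<phi> j)\<close> (\<open>capra_conj_l0\<close>), and \<open>L0\<close> is
the supremum of the affine functions \<open>x \<mapsto> x \<bullet> y - g y\<close>. This gives convexity, lower
semicontinuity, properness and the conjugate formula.

That \<open>L0\<close> agrees with \<open>\<phi> \<circ> \<ell>\<^sub>0\<close> on the unit sphere (\<open>L0_unit\<close>) is where strictness enters.
A unit vector \<open>s\<close> has a dual vector \<open>y\<close> with exactly the same support
(\<open>dual_vector_full_support\<close>). Deleting entries from \<open>y\<close> strictly decreases its dual norm, so
\<open>top\<^sub>j y < s \<bullet> y\<close> for every \<open>j < \<ell>\<^sub>0 s\<close>, and a large multiple of \<open>y\<close> makes the terms of \<open>g\<close>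
with \<open>j < \<ell>\<^sub>0 s\<close> harmless. The factorization through the normalization follows, and with it the
equality of the Fenchel conjugate of \<open>L0\<close> with the Capra conjugate of \<open>\<phi> \<circ> \<ell>\<^sub>0\<close>, hence of the
subdifferentials on the sphere.

Finally, \<open>g y\<close> is the value at \<open>(y, -1)\<close> of the support function of the compact set
\<open>\<Union>\<^sub>j B\<^sub>j \<times> {\<phi> j}\<close>. If
\<open>L0 x \<le> t\<close>, then the ray \<open>{x} \<times> {..t}\<close> meets the convex hull of this set, since a separating
hyperplane would give an affine minorant of \<open>L0\<close> above \<open>t\<close> at \<open>x\<close> (\<open>L0_le_imp_weighted_sum\<close>). A
point of the intersection is a convex combination that realizes the minimum over weighted sums of
balls. Rescaling its summands to the spheres gives the other two variational formulas. Any convex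
function below the \<open>\<phi> j\<close> on the balls (or only on the spheres) lies below these minima by Jensen's
inequality, so \<open>L0\<close> is the largest one.
\<close>

section \<open>Duality of norms\<close>

lemma is_norm_zero: "is_norm N \<Longrightarrow> N 0 = 0"
  by (simp add: is_norm_def)

lemma is_norm_eq_0_iff: "is_norm N \<Longrightarrow> N x = 0 \<longleftrightarrow> x = 0"
  by (simp add: is_norm_def)

lemma is_norm_scaleR: "is_norm N \<Longrightarrow> N (c *\<^sub>R x) = \<bar>c\<bar> * N x"
  by (simp add: is_norm_def)

lemma is_norm_triangle: "is_norm N \<Longrightarrow> N (x + y) \<le> N x + N y"
  by (simp add: is_norm_def)

lemma is_norm_minus: "is_norm N \<Longrightarrow> N (- x) = N x"
  using is_norm_scaleR[of N "-1" x] by simp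

lemma is_norm_nonneg: "is_norm N \<Longrightarrow> 0 \<le> N x"
  using is_norm_triangle[of N x "- x"] by (simp add: is_norm_zero is_norm_minus)

lemma is_norm_pos: "is_norm N \<Longrightarrow> x \<noteq> 0 \<Longrightarrow> 0 < N x"
  using is_norm_nonneg[of N x] by (simp add: is_norm_eq_0_iff order_less_le)

lemma is_norm_unit: "is_norm N \<Longrightarrow> x \<noteq> 0 \<Longrightarrow> N ((1 / N x) *\<^sub>R x) = 1"
  using is_norm_pos[of N x] by (simp add: is_norm_scaleR)

lemma is_norm_convex_on: 
  assumes "is_norm N" shows "convex_on UNIV N"
proof (rule convex_onI)
  fix t :: real and x y assume "0 < t" "t < 1"
  then show "N ((1 - t) *\<^sub>R x + t *\<^sub>R y) \<le> (1 - t) * N x + t * N y"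
    using is_norm_triangle[OF assms, of "(1 - t) *\<^sub>R x" "t *\<^sub>R y"] by (simp add: is_norm_scaleR[OF assms])
qed simp

lemma convex_unit_ball: 
  assumes "is_norm N" shows "convex {x. N x \<le> 1}"
proof (rule convexI)
  fix x y and u v :: real
  assume *: "x \<in> {x. N x \<le> 1}" "y \<in> {x. N x \<le> 1}" "0 \<le> u" "0 \<le> v" "u + v = 1"
  have "N (u *\<^sub>R x + v *\<^sub>R y) \<le> u * N x + v * N y"
    using is_norm_triangle[OF assms, of "u *\<^sub>R x" "v *\<^sub>R y"] * by (simp add: is_norm_scaleR[OF assms])
  also have "\<dots> \<le> 1" using * by (intro convex_bound_le) auto
  finally show "u *\<^sub>R x + v *\<^sub>R y \<in> {x. N x \<le> 1}" by simp
qed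

context
  fixes N :: "'a::euclidean_space \<Rightarrow> real"
  assumes N: "is_norm N"
begin

lemma is_norm_continuous_on: "continuous_on S N"
  using convex_on_continuous[OF open_UNIV is_norm_convex_on[OF N]] continuous_on_subset by blast

text \<open>A norm is continuous and positive on the compact Euclidean unit sphere, so its minimum there
is positive.\<close>

lemma is_norm_dominates_norm: "\<exists>c>0. \<forall>x. norm x \<le> c * N x"
proof -
  have "compact (sphere (0::'a) 1)" "sphere (0::'a) 1 \<noteq> {}" by auto
  then obtain z where z: "z \<in> sphere 0 1" "\<And>x. x \<in> sphere 0 1 \<Longrightarrow> N z \<le> N x"
    using continuous_attains_inf[OF _ _ is_norm_continuous_on, of "sphere 0 1"] by blast
  have pos: "0 < N z" using z(1) by (intro is_norm_pos[OF N]) auto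
  have "norm x \<le> (1 / N z) * N x" for x
  proof (cases "x = 0")
    case False
    then have "N z \<le> N ((1 / norm x) *\<^sub>R x)" by (intro z(2)) simp
    also have "\<dots> = N x / norm x" using False by (simp add: is_norm_scaleR[OF N])
    finally show ?thesis using False pos by (simp add: field_simps)
  qed (simp add: is_norm_zero[OF N])
  then show ?thesis using pos by (intro exI[of _ "1 / N z"]) auto
qed

lemma compact_unit_ball: "compact {x. N x \<le> 1}"
proof -
  obtain c where c: "c > 0" "\<And>x. norm x \<le> c * N x" using is_norm_dominates_norm by blast
  have "norm x \<le> c" if "N x \<le> 1" for x
    using order_trans[OF c(2) mult_left_le[OF that]] c(1) by simp
  then have "bounded {x. N x \<le> 1}" by (auto simp: bounded_iff)
  moreover have "closed {x. N x \<le> 1}"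
    by (intro closed_Collect_le is_norm_continuous_on continuous_on_const)
  ultimately show ?thesis by (simp add: compact_eq_bounded_closed)
qed

lemma dual_norm_attained: "\<exists>x. N x \<le> 1 \<and> x \<bullet> y = dual_norm N y"
proof -
  have "continuous_on {x. N x \<le> 1} (\<lambda>x. x \<bullet> y)" by (intro continuous_intros)
  moreover have "{x. N x \<le> 1} \<noteq> {}" using is_norm_zero[OF N] by (auto intro: exI[of _ 0])
  ultimately obtain x where x: "N x \<le> 1" "\<And>z. N z \<le> 1 \<Longrightarrow> z \<bullet> y \<le> x \<bullet> y"
    using continuous_attains_sup[OF compact_unit_ball, of "\<lambda>x. x \<bullet> y"] by blast
  then have "dual_norm N y = x \<bullet> y"
    unfolding dual_norm_def by (intro cSup_eq_maximum) (auto intro: imageI)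
  then show ?thesis using x by auto
qed

lemma inner_le_dual_norm_unit: 
  assumes "N x \<le> 1" shows "x \<bullet> y \<le> dual_norm N y"
proof -
  have "compact ((\<lambda>x. x \<bullet> y) ` {x. N x \<le> 1})"
    by (intro compact_continuous_image compact_unit_ball continuous_intros)
  then have "bdd_above ((\<lambda>x. x \<bullet> y) ` {x. N x \<le> 1})"
    by (intro bounded_imp_bdd_above compact_imp_bounded)
  then show ?thesis unfolding dual_norm_def using assms by (intro cSUP_upper) auto
qed

lemma inner_le_dual_norm: "x \<bullet> y \<le> N x * dual_norm N y"
proof (cases "x = 0")
  case False
  have "((1 / N x) *\<^sub>R x) \<bullet> y \<le> dual_norm N y"
    by (intro inner_le_dual_norm_unit) (simp add: is_norm_unit[OF N False])
  then show ?thesis using is_norm_pos[OF N False] by (simp add: field_simps)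
qed (simp add: is_norm_zero[OF N])

lemma dual_norm_le:
  assumes "\<And>x. N x \<le> 1 \<Longrightarrow> x \<bullet> y \<le> c" shows "dual_norm N y \<le> c"
  using dual_norm_attained[of y] assms by metis

lemma is_norm_dual_norm: "is_norm (dual_norm N)"
proof -
  have ge0: "0 \<le> dual_norm N y" for y
    using inner_le_dual_norm_unit[of 0 y] by (simp add: is_norm_zero[OF N])
  have le: "dual_norm N (c *\<^sub>R y) \<le> \<bar>c\<bar> * dual_norm N y" for c y
  proof (rule dual_norm_le)
    fix x assume x: "N x \<le> 1"
    have "x \<bullet> c *\<^sub>R y = (c *\<^sub>R x) \<bullet> y" by simp
    also have "\<dots> \<le> (\<bar>c\<bar> * N x) * dual_norm N y"
      using inner_le_dual_norm[of "c *\<^sub>R x" y] by (simp add: is_norm_scaleR[OF N])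
    also have "\<dots> \<le> \<bar>c\<bar> * dual_norm N y"
      using x ge0 by (intro mult_right_mono mult_left_le) auto
    finally show "x \<bullet> c *\<^sub>R y \<le> \<bar>c\<bar> * dual_norm N y" .
  qed
  have zero: "dual_norm N 0 = 0" using le[of 0 0] ge0[of 0] by simp
  have scale: "dual_norm N (c *\<^sub>R y) = \<bar>c\<bar> * dual_norm N y" for c y
  proof (cases "c = 0")
    case False
    have "dual_norm N (inverse c *\<^sub>R (c *\<^sub>R y)) \<le> \<bar>inverse c\<bar> * dual_norm N (c *\<^sub>R y)" by (rule le)
    then have "\<bar>c\<bar> * dual_norm N y \<le> dual_norm N (c *\<^sub>R y)"
      using False by (simp add: field_simps)
    then show ?thesis using le[of c y] by simp
  qed (simp add: zero)
  have definite: "y = 0" if "dual_norm N y = 0" for y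
    using inner_le_dual_norm[of y y] that inner_gt_zero_iff[of y] by fastforce
  have triangle: "dual_norm N (y + z) \<le> dual_norm N y + dual_norm N z" for y z
    by (rule dual_norm_le) (simp add: inner_add_right add_mono inner_le_dual_norm_unit)
  show ?thesis unfolding is_norm_def using zero scale definite triangle by blast
qed

end

lemma is_norm_eqI:
  assumes "is_norm M" "is_norm N" "\<And>x. M x \<le> 1 \<longleftrightarrow> N x \<le> 1"
  shows "M = N"
proof -
  have le: "P x \<le> Q x" 
    if "is_norm P" "is_norm Q" and sub: "\<And>x. Q x \<le> 1 \<Longrightarrow> P x \<le> 1" for P Q x
  proof (cases "x = 0")
    case False
    have "P ((1 / Q x) *\<^sub>R x) \<le> 1" by (intro sub) (simp add: is_norm_unit that False)
    then show ?thesis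
      using is_norm_pos[OF \<open>is_norm Q\<close> False] by (simp add: is_norm_scaleR[OF \<open>is_norm P\<close>] field_simps)
  qed (simp add: is_norm_zero that)
  have "M x \<le> N x" for x by (rule le[OF assms(1,2)]) (simp only: assms(3))
  moreover have "N x \<le> M x" for x by (rule le[OF assms(2,1)]) (simp only: assms(3))
  ultimately show ?thesis by (intro ext antisym)
qed

text \<open>The bipolar theorem for norms: a point outside the unit ball of \<open>N\<close> is cut off by a hyperplane,
whose normal is a vector witnessing that the bidual norm of the point exceeds \<open>1\<close>.\<close>

lemma dual_dual_norm:
  fixes N :: "'a::euclidean_space \<Rightarrow> real"
  assumes N: "is_norm N"
  shows "dual_norm (dual_norm N) = N"
proof (rule is_norm_eqI)
  note D = is_norm_dual_norm[OF N]
  show "is_norm (dual_norm (dual_norm N))" by (rule is_norm_dual_norm[OF D])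
  show "is_norm N" by (rule N)
  fix x
  have "N x \<le> 1" if le: "dual_norm (dual_norm N) x \<le> 1"
  proof (rule ccontr)
    assume "\<not> N x \<le> 1"
    then have "x \<notin> {x. N x \<le> 1}" by simp
    then obtain a b where ab: "a \<bullet> x < b" "\<And>z. N z \<le> 1 \<Longrightarrow> b < a \<bullet> z"
      using separating_hyperplane_closed_point[OF convex_unit_ball[OF N] 
          compact_imp_closed[OF compact_unit_ball[OF N]]] by blast
    have "dual_norm N (- a) \<le> - b"
      using ab(2) by (intro dual_norm_le[OF N]) (simp add: inner_commute less_imp_le)
    also have "\<dots> < (- a) \<bullet> x" using ab(1) by simp
    also have "\<dots> \<le> dual_norm N (- a) * dual_norm (dual_norm N) x"
      by (rule inner_le_dual_norm[OF D])
    also have "\<dots> \<le> dual_norm N (- a)"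
      using le is_norm_nonneg[OF D] by (rule mult_left_le)
    finally show False by simp
  qed
  moreover have "dual_norm (dual_norm N) x \<le> 1" if "N x \<le> 1"
  proof (rule dual_norm_le[OF D])
    fix y assume "dual_norm N y \<le> 1"
    then show "y \<bullet> x \<le> 1"
      using inner_le_dual_norm_unit[OF N that, of y] by (simp add: inner_commute)
  qed
  ultimately show "dual_norm (dual_norm N) x \<le> 1 \<longleftrightarrow> N x \<le> 1" by blast
qed

lemma dual_norm_antimono:
  fixes M N :: "'a::euclidean_space \<Rightarrow> real"
  assumes "is_norm M" "is_norm N" "\<And>x. M x \<le> N x"
  shows "dual_norm N y \<le> dual_norm M y"
proof (rule dual_norm_le[OF assms(2)])
  fix x assume "N x \<le> 1"
  with assms(3)[of x] have "M x \<le> 1" by linarith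
  then show "x \<bullet> y \<le> dual_norm M y" by (rule inner_le_dual_norm_unit[OF assms(1)])
qed

section \<open>Restriction of vectors, top dual norms and support dual norms\<close>

lemma restrict_vec_nth [simp]: "restrict_vec K y $ i = (if i \<in> K then y $ i else 0)"
  by (simp add: restrict_vec_def)

lemma restrict_vec_scaleR: "restrict_vec K (c *\<^sub>R y) = c *\<^sub>R restrict_vec K y"
  by (simp add: vec_eq_iff)

lemma restrict_vec_add: "restrict_vec K (x + y) = restrict_vec K x + restrict_vec K y"
  by (simp add: vec_eq_iff)

lemma restrict_vec_UNIV: "restrict_vec UNIV y = y"
  by (simp add: vec_eq_iff)

lemma restrict_vec_support: "{i. y $ i \<noteq> 0} \<subseteq> K \<Longrightarrow> restrict_vec K y = y"
  by (auto simp: vec_eq_iff)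

lemma inner_restrict_vec: "x \<bullet> restrict_vec K y = restrict_vec K x \<bullet> y"
  by (auto simp: inner_vec_def intro!: sum.cong)

lemma l0_le_card: "l0 (x :: real^'n) \<le> CARD('n)"
  unfolding l0_def by (rule card_mono) auto

lemma l0_pos: "x \<noteq> 0 \<Longrightarrow> 0 < l0 x"
  by (auto simp: l0_def card_gt_0_iff vec_eq_iff)

lemma l0_scaleR: "c \<noteq> 0 \<Longrightarrow> l0 (c *\<^sub>R x) = l0 x"
  by (simp add: l0_def)

lemma l0_restrict_vec_le: "l0 (restrict_vec K y) \<le> card K"
  unfolding l0_def by (rule card_mono) auto

text \<open>The instance of orthant-strict monotonicity on which all later arguments rest.\<close>

lemma norm_restrict_less:
  assumes "orthant_strictly_monotonic N" "i \<notin> K" "x $ i \<noteq> 0"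
  shows "N (restrict_vec K x) < N x"
proof -
  have "(\<forall>i. \<bar>restrict_vec K x $ i\<bar> \<le> \<bar>x $ i\<bar>) \<and> (\<exists>j. \<bar>restrict_vec K x $ j\<bar> < \<bar>x $ j\<bar>)
      \<and> (\<forall>i. restrict_vec K x $ i * x $ i \<ge> 0)"
    using assms(2,3) by (auto intro!: exI[of _ i])
  then show ?thesis using assms(1) unfolding orthant_strictly_monotonic_def by blast
qed

lemma norm_restrict_le:
  assumes "orthant_strictly_monotonic N"
  shows "N (restrict_vec K x) \<le> N x"
proof (cases "{i. x $ i \<noteq> 0} \<subseteq> K")
  case True
  then show ?thesis by (simp add: restrict_vec_support)
next
  case False
  then show ?thesis using norm_restrict_less[OF assms] by (auto intro: less_imp_le)
qed

context
  fixes N :: "real^'n \<Rightarrow> real"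
  assumes N: "is_norm N"
begin

lemma dual_restrict_le_top_dual_norm:
  assumes "card K \<le> k"
  shows "dual_norm N (restrict_vec K y) \<le> top_dual_norm N k y"
proof (cases "k = 0")
  case True
  then have "K = {}" using assms by simp
  then show ?thesis using True is_norm_zero[OF is_norm_dual_norm[OF N]]
    by (simp add: top_dual_norm_def restrict_vec_def zero_vec_def[symmetric])
next
  case False
  have "finite ((\<lambda>K. dual_norm N (restrict_vec K y)) ` {K. card K \<le> k})" by simp
  then show ?thesis using False assms
    by (auto simp: top_dual_norm_def intro!: cSUP_upper bdd_above_finite)
qed

lemma top_dual_norm_attained:
  "\<exists>K. card K \<le> k \<and> top_dual_norm N k y = dual_norm N (restrict_vec K y)"
proof (cases "k = 0")
  case True
  then show ?thesis using is_norm_zero[OF is_norm_dual_norm[OF N]]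
    by (intro exI[of _ "{}"]) (simp add: top_dual_norm_def restrict_vec_def zero_vec_def[symmetric])
next
  case False
  let ?V = "(\<lambda>K. dual_norm N (restrict_vec K y)) ` {K. card K \<le> k}"
  have "finite ?V" "?V \<noteq> {}" by (auto intro: exI[of _ "{}"])
  then have "Sup ?V \<in> ?V" by (metis Max_in cSup_eq_Max)
  then show ?thesis using False by (auto simp: top_dual_norm_def)
qed

lemma top_dual_norm_nonneg: "0 \<le> top_dual_norm N k y"
  using top_dual_norm_attained[of k y] is_norm_nonneg[OF is_norm_dual_norm[OF N]] by metis

lemma top_dual_norm_mono: "j \<le> k \<Longrightarrow> top_dual_norm N j y \<le> top_dual_norm N k y"
  using top_dual_norm_attained[of j y] dual_restrict_le_top_dual_norm order_trans by metis

lemma top_dual_norm_scaleR: "top_dual_norm N k (c *\<^sub>R y) = \<bar>c\<bar> * top_dual_norm N k y"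
proof (rule antisym)
  note scale = is_norm_scaleR[OF is_norm_dual_norm[OF N]]
  obtain K where "card K \<le> k" "top_dual_norm N k (c *\<^sub>R y) = dual_norm N (restrict_vec K (c *\<^sub>R y))"
    using top_dual_norm_attained by blast
  then show "top_dual_norm N k (c *\<^sub>R y) \<le> \<bar>c\<bar> * top_dual_norm N k y"
    using dual_restrict_le_top_dual_norm[of K k y]
    by (simp add: restrict_vec_scaleR scale mult_left_mono)
  obtain K where "card K \<le> k" "top_dual_norm N k y = dual_norm N (restrict_vec K y)"
    using top_dual_norm_attained by blast
  then show "\<bar>c\<bar> * top_dual_norm N k y \<le> top_dual_norm N k (c *\<^sub>R y)"
    using dual_restrict_le_top_dual_norm[of K k "c *\<^sub>R y"]
    by (simp add: restrict_vec_scaleR scale)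
qed

text \<open>For \<open>k \<ge> 1\<close> the singletons are among the index sets, so a vector on which the top-\<open>k\<close> dual norm
vanishes has no nonzero entry.\<close>

lemma is_norm_top_dual_norm:
  assumes "1 \<le> k" shows "is_norm (top_dual_norm N k)"
proof -
  note D = is_norm_dual_norm[OF N]
  have zero: "top_dual_norm N k 0 = 0" using top_dual_norm_scaleR[of k 0 0] by simp
  have definite: "y = 0" if "top_dual_norm N k y = 0" for y
  proof -
    have "restrict_vec {i} y = 0" for i
    proof -
      have "dual_norm N (restrict_vec {i} y) \<le> 0"
        using dual_restrict_le_top_dual_norm[of "{i}" k y] assms that by simp
      then show ?thesis using is_norm_pos[OF D, of "restrict_vec {i} y"] by linarith
    qed
    then have "y $ i = 0" for i by (metis insertI1 restrict_vec_nth zero_index)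
    then show ?thesis by (simp add: vec_eq_iff)
  qed
  have triangle: "top_dual_norm N k (x + y) \<le> top_dual_norm N k x + top_dual_norm N k y" for x y
  proof -
    obtain K where K: "card K \<le> k" "top_dual_norm N k (x + y) = dual_norm N (restrict_vec K (x + y))"
      using top_dual_norm_attained by blast
    show ?thesis
      unfolding K(2) restrict_vec_add
      using is_norm_triangle[OF D, of "restrict_vec K x" "restrict_vec K y"]
        dual_restrict_le_top_dual_norm[OF K(1), of x] dual_restrict_le_top_dual_norm[OF K(1), of y]
      by linarith
  qed
  show ?thesis unfolding is_norm_def
    using zero definite top_dual_norm_scaleR triangle by blast
qed

lemma is_norm_support_dual_norm: "1 \<le> k \<Longrightarrow> is_norm (support_dual_norm N k)"
  unfolding support_dual_norm_def by (intro is_norm_dual_norm is_norm_top_dual_norm)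

text \<open>The identity behind all support-function arguments below: \<open>top_dual_norm N k\<close> is the support
function of the unit ball of \<open>support_dual_norm N k\<close>.\<close>

lemma dual_support_dual_norm: "1 \<le> k \<Longrightarrow> dual_norm (support_dual_norm N k) = top_dual_norm N k"
  unfolding support_dual_norm_def by (intro dual_dual_norm is_norm_top_dual_norm)

lemma support_dual_norm_antimono:
  assumes "1 \<le> j" "j \<le> k" shows "support_dual_norm N k x \<le> support_dual_norm N j x"
  unfolding support_dual_norm_def
  by (rule dual_norm_antimono) (use assms in \<open>auto intro: is_norm_top_dual_norm top_dual_norm_mono\<close>)

lemma inner_le_top_dual_norm:
  assumes "x \<in> support_ball N j" shows "x \<bullet> y \<le> top_dual_norm N j y"
proof (cases "j = 0")
  case False
  then show ?thesis
    using assms inner_le_dual_norm_unit[OF is_norm_support_dual_norm, of j x y]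
    by (simp add: dual_support_dual_norm support_ball_def)
qed (use assms in \<open>simp add: support_ball_def top_dual_norm_def\<close>)

lemma top_dual_norm_attained_on_support_ball:
  "\<exists>x\<in>support_ball N j. x \<bullet> y = top_dual_norm N j y"
proof (cases "j = 0")
  case False
  then show ?thesis
    using dual_norm_attained[OF is_norm_support_dual_norm, of j y]
    by (simp add: dual_support_dual_norm support_ball_def)
qed (simp add: support_ball_def top_dual_norm_def)

lemma zero_mem_support_ball: "0 \<in> support_ball N j"
  by (auto simp: support_ball_def is_norm_zero[OF is_norm_support_dual_norm] Suc_le_eq)

lemma convex_support_ball: "convex (support_ball N j)"
  by (auto simp: support_ball_def Suc_le_eq intro!: convex_unit_ball is_norm_support_dual_norm)

lemma compact_support_ball: "compact (support_ball N j)"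
  by (auto simp: support_ball_def Suc_le_eq intro!: compact_unit_ball is_norm_support_dual_norm)

lemma support_ball_mono:
  assumes "j \<le> k" shows "support_ball N j \<subseteq> support_ball N k"
proof (cases "j = 0")
  case True
  then show ?thesis using zero_mem_support_ball[of k] by (simp add: support_ball_def)
next
  case False
  then show ?thesis using assms support_dual_norm_antimono[of j k] order_trans
    by (fastforce simp: support_ball_def)
qed

lemma support_sphere_subset_ball: "support_sphere N j \<subseteq> support_ball N j"
  by (auto simp: support_sphere_def support_ball_def)

lemma support_sphere_nonempty: 
  assumes "1 \<le> j" obtains u where "u \<in> support_sphere N j"
proof
  show "(1 / support_dual_norm N j 1) *\<^sub>R 1 \<in> support_sphere N j"
    using assms is_norm_unit[OF is_norm_support_dual_norm[OF assms], of 1]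
    by (simp add: support_sphere_def vec_eq_iff)
qed

end

section \<open>Lower addition and suprema of affine functions\<close>

lemma lower_add_ereal: "ereal a \<plusdot> ereal b = ereal (a + b)"
  by (simp add: lower_add_def)

lemma lower_add_minus_le_iff: "ereal a \<plusdot> (- v) \<le> ereal b \<longleftrightarrow> ereal (a - b) \<le> v"
  by (cases v) (auto simp: lower_add_def)

lemma lsc_fun_SUP_affine:
  fixes b :: "'a::euclidean_space \<Rightarrow> real"
  shows "lsc_fun (\<lambda>x. SUP y. ereal (x \<bullet> y - b y))"
  unfolding lsc_fun_def
proof (intro allI SUP_least)
  fix x y :: 'a
  have "((\<lambda>z. ereal (z \<bullet> y - b y)) \<longlongrightarrow> ereal (x \<bullet> y - b y)) (at x)"
    by (intro tendsto_intros)
  then have "ereal (x \<bullet> y - b y) = Liminf (at x) (\<lambda>z. ereal (z \<bullet> y - b y))"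
    by (intro lim_imp_Liminf[symmetric]) simp_all
  also have "\<dots> \<le> Liminf (at x) (\<lambda>x. SUP y. ereal (x \<bullet> y - b y))"
    by (intro Liminf_mono always_eventually allI SUP_upper) simp
  finally show "ereal (x \<bullet> y - b y) \<le> Liminf (at x) (\<lambda>x. SUP y. ereal (x \<bullet> y - b y))" .
qed

lemma convex_fun_SUP_affine:
  fixes b :: "'a::euclidean_space \<Rightarrow> real"
  shows "convex_fun (\<lambda>x. SUP y. ereal (x \<bullet> y - b y))"
proof -
  have "{(x, t::real). (SUP y. ereal (x \<bullet> y - b y)) \<le> ereal t} = (\<Inter>y. {p. (y, -1) \<bullet> p \<le> b y})"
    by (auto simp: SUP_le_iff inner_prod_def inner_commute algebra_simps)
  then show ?thesis
    unfolding convex_fun_def by (simp only:) (intro convex_INT ballI convex_halfspace_le)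
qed

section \<open>The Capra conjugate of functions of the pseudonorm\<close>

text \<open>A real-valued maximum instead of an extended-real supremum: being finite, it can be subtracted
and scaled with ordinary arithmetic.\<close>

definition penalized_top_norm :: "(real^'n \<Rightarrow> real) \<Rightarrow> (nat \<Rightarrow> real) \<Rightarrow> real^'n \<Rightarrow> real"
  where "penalized_top_norm N \<phi> y = (MAX j\<in>{0..CARD('n)}. top_dual_norm N j y - \<phi> j)"

locale capra_l0 =
  fixes N :: "real^'n \<Rightarrow> real" and \<phi> :: "nat \<Rightarrow> real"
  assumes norm: "is_norm N"
    and strict: "orthant_strictly_monotonic N"
    and dual_strict: "orthant_strictly_monotonic (dual_norm N)"
    and phi_nonneg: "\<And>j. j \<le> CARD('n) \<Longrightarrow> 0 \<le> \<phi> j"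
    and phi_mono: "\<And>i j. i \<le> j \<Longrightarrow> j \<le> CARD('n) \<Longrightarrow> \<phi> i \<le> \<phi> j"
    and phi_0: "\<phi> 0 = 0"
begin

abbreviation g where "g \<equiv> penalized_top_norm N \<phi>"

lemma top_dual_norm_minus_phi_le_g: "j \<le> CARD('n) \<Longrightarrow> top_dual_norm N j y - \<phi> j \<le> g y"
  unfolding penalized_top_norm_def by (intro Max_ge) auto

lemma g_attained: obtains j where "j \<le> CARD('n)" "g y = top_dual_norm N j y - \<phi> j"
proof -
  have "g y \<in> (\<lambda>j. top_dual_norm N j y - \<phi> j) ` {0..CARD('n)}"
    unfolding penalized_top_norm_def by (intro Max_in) auto
  then show ?thesis using that by auto
qed

lemma g_nonneg: "0 \<le> g y"
  using top_dual_norm_minus_phi_le_g[of 0 y] by (simp add: phi_0 top_dual_norm_def)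

lemma ereal_g_eq_SUP: "ereal (g y) = (SUP j\<in>{0..CARD('n)}. ereal (top_dual_norm N j y - \<phi> j))"
proof (rule antisym)
  obtain j where "j \<le> CARD('n)" "g y = top_dual_norm N j y - \<phi> j" by (rule g_attained)
  then show "ereal (g y) \<le> (SUP j\<in>{0..CARD('n)}. ereal (top_dual_norm N j y - \<phi> j))"
    by (auto intro!: SUP_upper)
qed (auto intro!: SUP_least simp: top_dual_norm_minus_phi_le_g)

lemma top_dual_norm_card: "top_dual_norm N CARD('n) y = dual_norm N y"
proof (rule antisym)
  show "top_dual_norm N CARD('n) y \<le> dual_norm N y"
    using top_dual_norm_attained[OF norm] norm_restrict_le[OF dual_strict] by metis
  show "dual_norm N y \<le> top_dual_norm N CARD('n) y"
    using dual_restrict_le_top_dual_norm[OF norm, of UNIV "CARD('n)" y] by (simp add: restrict_vec_UNIV)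
qed

lemma support_dual_norm_card: "support_dual_norm N CARD('n) = N"
  unfolding support_dual_norm_def top_dual_norm_card[abs_def] by (rule dual_dual_norm[OF norm])

lemma support_ball_card: "support_ball N CARD('n) = {x. N x \<le> 1}"
  by (simp add: support_ball_def support_dual_norm_card)

text \<open>Only the entries of \<open>y\<close> on the support of \<open>x\<close> matter for \<open>x \<bullet> y\<close>.\<close>

lemma inner_le_top_dual_norm_l0: "x \<bullet> y \<le> N x * top_dual_norm N (l0 x) y"
proof -
  let ?K = "{i. x $ i \<noteq> 0}"
  have "x \<bullet> y = x \<bullet> restrict_vec ?K y"
    by (simp add: inner_restrict_vec restrict_vec_support)
  also have "\<dots> \<le> N x * dual_norm N (restrict_vec ?K y)"
    by (rule inner_le_dual_norm[OF norm])
  also have "\<dots> \<le> N x * top_dual_norm N (l0 x) y"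
    by (intro mult_left_mono dual_restrict_le_top_dual_norm[OF norm] is_norm_nonneg[OF norm])
       (simp add: l0_def)
  finally show ?thesis .
qed

text \<open>If \<open>z\<close> is a maximizer for the restriction of \<open>y\<close> to \<open>K\<close>, then so is its own restriction to \<open>K\<close>,
which stays in the unit ball by orthant monotonicity of \<open>N\<close>. Thus top dual norms are suprema over
sparse vectors of the unit ball.\<close>

lemma top_dual_norm_attained_sparse:
  obtains x where "l0 x \<le> j" "N x \<le> 1" "x \<bullet> y = top_dual_norm N j y"
proof -
  obtain K where K: "card K \<le> j" "top_dual_norm N j y = dual_norm N (restrict_vec K y)"
    using top_dual_norm_attained[OF norm] by blast
  obtain z where z: "N z \<le> 1" "z \<bullet> restrict_vec K y = dual_norm N (restrict_vec K y)"
    using dual_norm_attained[OF norm] by blast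
  show ?thesis
  proof
    show "l0 (restrict_vec K z) \<le> j" using l0_restrict_vec_le[of K z] K(1) by linarith
    show "N (restrict_vec K z) \<le> 1" using norm_restrict_le[OF strict, of K z] z(1) by linarith
    show "restrict_vec K z \<bullet> y = top_dual_norm N j y" 
      using z(2) K(2) by (simp add: inner_restrict_vec)
  qed
qed

text \<open>The coupling only sees the direction of \<open>x\<close>. For the lower bound, a sparse maximizer inside the
unit ball is pushed to the sphere by the coupling, which can only increase a nonnegative value; its
number of nonzero entries may be less than \<open>j\<close>, and monotonicity of \<open>\<phi>\<close> covers this case.\<close>

lemma capra_conj_l0: "capra_conj N (ereal \<circ> \<phi> \<circ> l0) = (\<lambda>y. ereal (g y))"
proof
  fix y
  have "(SUP x. ereal (capra_coupling N x y - \<phi> (l0 x))) = ereal (g y)"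
  proof (rule antisym)
    show "(SUP x. ereal (capra_coupling N x y - \<phi> (l0 x))) \<le> ereal (g y)"
    proof (rule SUP_least)
      fix x :: "real^'n"
      have "capra_coupling N x y \<le> top_dual_norm N (l0 x) y"
      proof (cases "x = 0")
        case False
        then show ?thesis using inner_le_top_dual_norm_l0[of x y] is_norm_pos[OF norm False]
          by (simp add: capra_coupling_def pos_divide_le_eq mult.commute)
      qed (simp add: capra_coupling_def top_dual_norm_nonneg[OF norm])
      then show "ereal (capra_coupling N x y - \<phi> (l0 x)) \<le> ereal (g y)"
        using top_dual_norm_minus_phi_le_g[OF l0_le_card, of x y] by simp
    qed
    obtain j where j: "j \<le> CARD('n)" "g y = top_dual_norm N j y - \<phi> j" by (rule g_attained)
    obtain x where x: "l0 x \<le> j" "N x \<le> 1" "x \<bullet> y = top_dual_norm N j y"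
      by (rule top_dual_norm_attained_sparse)
    have "x \<bullet> y \<le> capra_coupling N x y"
    proof (cases "x = 0")
      case False
      have "(x \<bullet> y) * N x \<le> x \<bullet> y"
        using x(2) unfolding x(3) by (intro mult_left_le top_dual_norm_nonneg[OF norm])
      then show ?thesis using is_norm_pos[OF norm False] False
        by (simp add: capra_coupling_def pos_le_divide_eq)
    qed (simp add: capra_coupling_def)
    moreover have "\<phi> (l0 x) \<le> \<phi> j" using x(1) j(1) by (rule phi_mono)
    ultimately have "ereal (g y) \<le> ereal (capra_coupling N x y - \<phi> (l0 x))" 
      using j(2) x(3) by simp
    also have "\<dots> \<le> (SUP x. ereal (capra_coupling N x y - \<phi> (l0 x)))" by (rule SUP_upper) simp
    finally show "ereal (g y) \<le> (SUP x. ereal (capra_coupling N x y - \<phi> (l0 x)))" .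
  qed
  then show "capra_conj N (ereal \<circ> \<phi> \<circ> l0) y = ereal (g y)"
    by (simp add: conj_fun_def lower_add_ereal)
qed

lemma L0_eq_SUP: "L0 N \<phi> = (\<lambda>x. SUP y. ereal (x \<bullet> y - g y))"
  by (intro ext) (simp add: L0_def capra_conj_l0 conj_fun_def lower_add_ereal)

lemma affine_le_L0: "ereal (x \<bullet> y - g y) \<le> L0 N \<phi> x"
  unfolding L0_eq_SUP by (rule SUP_upper) simp

lemma L0_nonneg: "0 \<le> L0 N \<phi> x"
proof -
  obtain j where "j \<le> CARD('n)" "g 0 = top_dual_norm N j 0 - \<phi> j" by (rule g_attained)
  then have "g 0 \<le> 0" using phi_nonneg[of j] top_dual_norm_scaleR[OF norm, of j 0 0] by simp
  then have "0 \<le> ereal (x \<bullet> 0 - g 0)" by simp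
  also have "\<dots> \<le> L0 N \<phi> x" by (rule affine_le_L0)
  finally show ?thesis .
qed

lemma L0_zero: "L0 N \<phi> 0 = 0"
  by (intro antisym L0_nonneg) (simp add: L0_eq_SUP SUP_le_iff g_nonneg)

section \<open>Equality on the unit sphere and the convex factorization\<close>

text \<open>Start from any norming vector of \<open>s\<close> and restrict it to the support of \<open>s\<close>: it still norms \<open>s\<close>,
and its dual norm is still \<open>1\<close> because the dual norm is orthant monotonic. If it vanished at an
index \<open>i\<close> of the support, it would also norm \<open>s\<close> with entry \<open>i\<close> deleted, a vector of norm strictly
less than \<open>1\<close>.\<close>

lemma dual_vector_full_support:
  assumes s: "N s = 1"
  obtains y where "s \<bullet> y = 1" "dual_norm N y = 1" "{i. y $ i \<noteq> 0} = {i. s $ i \<noteq> 0}"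
proof -
  note D = is_norm_dual_norm[OF norm]
  let ?K = "{i. s $ i \<noteq> 0}"
  obtain y0 where y0: "dual_norm N y0 \<le> 1" "y0 \<bullet> s = 1"
    using dual_norm_attained[OF D, of s] s by (auto simp: dual_dual_norm[OF norm])
  define y where "y = restrict_vec ?K y0"
  have sy: "s \<bullet> y = 1"
    using y0(2) by (simp add: y_def inner_restrict_vec restrict_vec_support inner_commute)
  have "dual_norm N y \<le> 1" 
    using norm_restrict_le[OF dual_strict, of ?K y0] y0(1) by (simp add: y_def)
  moreover have "1 \<le> dual_norm N y" using inner_le_dual_norm[OF norm, of s y] s sy by simp
  ultimately have dy: "dual_norm N y = 1" by simp
  have "y $ i \<noteq> 0" if i: "s $ i \<noteq> 0" for i
  proof
    assume yi: "y $ i = 0"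
    have "restrict_vec (- {i}) y = y" using yi by (auto intro: restrict_vec_support)
    then have "restrict_vec (- {i}) s \<bullet> y = 1" using sy by (simp flip: inner_restrict_vec)
    then have "1 \<le> N (restrict_vec (- {i}) s)"
      using inner_le_dual_norm[OF norm, of "restrict_vec (- {i}) s" y] dy by simp
    moreover have "N (restrict_vec (- {i}) s) < 1"
      using norm_restrict_less[OF strict, of i "- {i}" s] i s by simp
    ultimately show False by simp
  qed
  then have "{i. y $ i \<noteq> 0} = ?K" by (auto simp: y_def)
  with sy dy show ?thesis by (rule that)
qed

text \<open>For the lower bound, take the dual vector \<open>y\<close> with the support of \<open>s\<close> and let \<open>r < 1\<close> be its
top dual norm of index \<open>l0 s - 1\<close>. At \<open>t *\<^sub>R y\<close>, the terms of \<open>g\<close> of index \<open>j \<ge> l0 s\<close> are at most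
\<open>t - \<phi> (l0 s)\<close> by monotonicity of \<open>\<phi>\<close>, and the others are at most \<open>t * r\<close>.\<close>

lemma L0_unit:
  assumes s: "N s = 1" shows "L0 N \<phi> s = ereal (\<phi> (l0 s))"
proof (rule antisym)
  show "L0 N \<phi> s \<le> ereal (\<phi> (l0 s))"
  proof (unfold L0_eq_SUP, rule SUP_least)
    fix y
    have "s \<bullet> y \<le> top_dual_norm N (l0 s) y" using inner_le_top_dual_norm_l0[of s y] s by simp
    then show "ereal (s \<bullet> y - g y) \<le> ereal (\<phi> (l0 s))" using top_dual_norm_minus_phi_le_g[OF l0_le_card, of s y] by simp
  qed
next
  obtain y where y: "s \<bullet> y = 1" "dual_norm N y = 1" "{i. y $ i \<noteq> 0} = {i. s $ i \<noteq> 0}"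
    using dual_vector_full_support[OF s] by blast
  have "l0 s > 0" using s is_norm_zero[OF norm] by (intro l0_pos) auto
  define r where "r = top_dual_norm N (l0 s - 1) y"
  have "r < 1"
  proof -
    obtain K where K: "card K \<le> l0 s - 1" "r = dual_norm N (restrict_vec K y)"
      using top_dual_norm_attained[OF norm] unfolding r_def by blast
    have "\<not> {i. y $ i \<noteq> 0} \<subseteq> K"
      using K(1) \<open>l0 s > 0\<close> card_mono[of K "{i. y $ i \<noteq> 0}"] by (auto simp: y(3) l0_def)
    then obtain i where "i \<notin> K" "y $ i \<noteq> 0" by blast
    then show ?thesis using norm_restrict_less[OF dual_strict, of i K y] y(2) K(2) by simp
  qed
  \<comment> \<open>The least \<open>t\<close> with \<open>t * r \<le> t - \<phi> (l0 s)\<close>, so that both kinds of terms obey the same bound.\<close>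
  define t where "t = \<phi> (l0 s) / (1 - r)"
  have t: "0 \<le> t" "t * (1 - r) = \<phi> (l0 s)"
    using \<open>r < 1\<close> phi_nonneg[OF l0_le_card, of s] by (simp_all add: t_def)
  obtain j where j: "j \<le> CARD('n)" "g (t *\<^sub>R y) = top_dual_norm N j (t *\<^sub>R y) - \<phi> j"
    by (rule g_attained)
  have gj: "g (t *\<^sub>R y) = t * top_dual_norm N j y - \<phi> j"
    using j(2) t(1) by (simp add: top_dual_norm_scaleR[OF norm])
  have "\<phi> (l0 s) \<le> t - g (t *\<^sub>R y)"
  proof (cases "l0 s \<le> j")
    case True
    have "top_dual_norm N j y \<le> 1"
      using top_dual_norm_mono[OF norm j(1), of y] y(2) by (simp add: top_dual_norm_card)
    then have "t * top_dual_norm N j y \<le> t" using t(1) by (intro mult_left_le)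
    then show ?thesis using phi_mono[OF True j(1)] gj by simp
  next
    case False
    then have "top_dual_norm N j y \<le> r" 
      unfolding r_def by (intro top_dual_norm_mono[OF norm]) simp
    then have "t * top_dual_norm N j y \<le> t * r" using t(1) by (intro mult_left_mono)
    then show ?thesis using phi_nonneg[OF j(1)] gj t(2) by (simp add: algebra_simps)
  qed
  then have "ereal (\<phi> (l0 s)) \<le> ereal (s \<bullet> (t *\<^sub>R y) - g (t *\<^sub>R y))" by (simp add: y(1))
  also have "\<dots> \<le> L0 N \<phi> s" by (rule affine_le_L0)
  finally show "ereal (\<phi> (l0 s)) \<le> L0 N \<phi> s" .
qed

lemma L0_normalize: "L0 N \<phi> (normalize_by N x) = ereal (\<phi> (l0 x))"
proof (cases "x = 0")
  case True
  then show ?thesis by (simp add: normalize_by_def L0_zero l0_def phi_0 zero_ereal_def)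
next
  case False
  then have "N x \<noteq> 0" by (simp add: is_norm_eq_0_iff[OF norm])
  then show ?thesis using False L0_unit[OF is_norm_unit[OF norm False]]
    by (simp add: normalize_by_def l0_scaleR)
qed

text \<open>By the factorization, the supremum defining the Capra conjugate is the supremum defining the
Fenchel conjugate of \<open>L0\<close>, restricted to the unit sphere and the origin. The other inequality holds
since \<open>L0\<close> lies above its affine minorants.\<close>

lemma fenchel_conj_L0: "conj_fun (\<lambda>x y. x \<bullet> y) (L0 N \<phi>) = capra_conj N (ereal \<circ> \<phi> \<circ> l0)"
proof (intro ext antisym)
  fix y
  show "conj_fun (\<lambda>x y. x \<bullet> y) (L0 N \<phi>) y \<le> capra_conj N (ereal \<circ> \<phi> \<circ> l0) y"
    unfolding capra_conj_l0 conj_fun_def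
    by (intro SUP_least) (simp add: lower_add_minus_le_iff affine_le_L0)
  show "capra_conj N (ereal \<circ> \<phi> \<circ> l0) y \<le> conj_fun (\<lambda>x y. x \<bullet> y) (L0 N \<phi>) y"
    unfolding conj_fun_def
  proof (intro SUP_mono bexI)
    fix x :: "real^'n"
    show "ereal (capra_coupling N x y) \<plusdot> - (ereal \<circ> \<phi> \<circ> l0) x
        \<le> ereal (normalize_by N x \<bullet> y) \<plusdot> - L0 N \<phi> (normalize_by N x)"
      by (simp add: L0_normalize) (simp add: capra_coupling_def normalize_by_def)
  qed simp
qed

lemma subdiff_L0:
  assumes s: "N s = 1"
  shows "capra_subdiff N (ereal \<circ> \<phi> \<circ> l0) s = fenchel_subdiff (L0 N \<phi>) s"
proof -
  have "s \<noteq> 0" using s is_norm_zero[OF norm] by auto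
  then show ?thesis
    by (simp add: subdiff_def fenchel_conj_L0 L0_unit[OF s] capra_coupling_def s)
qed

end

section \<open>Minima, Minkowski sums and infima of characteristic functions\<close>

text \<open>The third assumption asks only for approximation from real bounds \<open>t \<ge> v\<close>: taking \<open>t = v\<close> gives the
minimizer when \<open>v\<close> is finite, and nothing is asked when \<open>v = \<infinity>\<close>.\<close>

lemma is_minimumI:
  assumes "v \<noteq> -\<infinity>" "\<And>a. a \<in> A \<Longrightarrow> v \<le> a" "\<And>t. v \<le> ereal t \<Longrightarrow> \<exists>a\<in>A. a \<le> ereal t"
  shows "is_minimum v A"
proof (cases v)
  case (real t)
  then obtain a where "a \<in> A" "a \<le> v" using assms(3)[of t] by auto
  then have "v \<in> A" using assms(2)[of a] by (metis antisym)
  moreover have "Inf A = v"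
    by (rule antisym) (use assms(2) \<open>v \<in> A\<close> in \<open>auto intro: Inf_lower Inf_greatest\<close>)
  ultimately show ?thesis by (simp add: is_minimum_def)
next
  case PInf
  then have "A \<subseteq> {\<infinity>}" using assms(2) by force
  then show ?thesis using PInf by (auto simp: is_minimum_def subset_singleton_iff top_ereal_def)
qed (use assms(1) in simp)

lemma mem_weighted_sum_iff:
  "x \<in> weighted_sum w A d \<longleftrightarrow> (\<exists>b. (\<forall>j\<in>{1..d}. b j \<in> A j) \<and> x = (\<Sum>j=1..d. w j *\<^sub>R b j))"
proof
  assume "x \<in> weighted_sum w A d"
  then obtain s where s: "x = sum s {1..d}" "\<forall>j\<in>{1..d}. s j \<in> (*\<^sub>R) (w j) ` A j"
    unfolding weighted_sum_def by (auto simp: set_sum_alt)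
  from s(2) obtain b where "\<forall>j\<in>{1..d}. b j \<in> A j \<and> s j = w j *\<^sub>R b j"
    unfolding image_iff by metis
  then show "\<exists>b. (\<forall>j\<in>{1..d}. b j \<in> A j) \<and> x = (\<Sum>j=1..d. w j *\<^sub>R b j)"
    using s(1) by (intro exI[of _ b]) simp
next
  assume "\<exists>b. (\<forall>j\<in>{1..d}. b j \<in> A j) \<and> x = (\<Sum>j=1..d. w j *\<^sub>R b j)"
  then obtain b where "\<forall>j\<in>{1..d}. b j \<in> A j" "x = (\<Sum>j=1..d. w j *\<^sub>R b j)" by blast
  then show "x \<in> weighted_sum w A d"
    unfolding weighted_sum_def by (auto simp: set_sum_alt intro!: exI[of _ "\<lambda>j. w j *\<^sub>R b j"])
qed

lemma inf_char_fun_le: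
  fixes A :: "nat \<Rightarrow> (real^'n) set"
  assumes "j \<le> CARD('n)" "x \<in> A j" shows "inf_char_fun A \<phi> x \<le> ereal (\<phi> j)"
  unfolding inf_char_fun_def by (rule INF_lower2[of j]) (use assms in \<open>auto simp: char_fun_def\<close>)

lemma inf_char_fun_eq_Inf:
  fixes A :: "nat \<Rightarrow> (real^'n) set"
  shows "inf_char_fun A \<phi> x = Inf {ereal (\<phi> j) | j. j \<in> {0..CARD('n)} \<and> x \<in> A j}"
proof (rule antisym)
  show "inf_char_fun A \<phi> x \<le> Inf {ereal (\<phi> j) | j. j \<in> {0..CARD('n)} \<and> x \<in> A j}"
    by (rule Inf_greatest) (auto intro: inf_char_fun_le)
  show "Inf {ereal (\<phi> j) | j. j \<in> {0..CARD('n)} \<and> x \<in> A j} \<le> inf_char_fun A \<phi> x"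
    unfolding inf_char_fun_def
    by (rule INF_greatest) (auto simp: char_fun_def intro!: Inf_lower)
qed

section \<open>Variational formulas and the largest convex minorant\<close>

text \<open>Jensen's inequality, read off in the epigraph of \<open>h\<close>: the points \<open>(b j, \<phi> j)\<close> belong to it, and so
does their convex combination. The weight of index \<open>0\<close> goes to the point \<open>(0, 0)\<close>, so it changes
neither \<open>x\<close> nor the cost.\<close>

lemma convex_fun_le_weighted_sum:
  fixes A :: "nat \<Rightarrow> (real^'n) set"
  assumes h: "convex_fun h" "h \<le> inf_char_fun A \<phi>"
    and A0: "0 \<in> A 0" and phi0: "\<phi> 0 = 0"
    and w: "w \<in> prob_simplex CARD('n)" and x: "x \<in> weighted_sum w A CARD('n)"
  shows "h x \<le> ereal (\<Sum>j=1..CARD('n). w j * \<phi> j)"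
proof -
  obtain b where b: "\<And>j. j \<in> {1..CARD('n)} \<Longrightarrow> b j \<in> A j" "x = (\<Sum>j=1..CARD('n). w j *\<^sub>R b j)"
    using x unfolding mem_weighted_sum_iff by blast
  define p where "p j = (if j = 0 then 0 else b j, \<phi> j)" for j
  have p: "p j \<in> {(x, t). h x \<le> ereal t}" if "j \<in> {0..CARD('n)}" for j
  proof -
    have "fst (p j) \<in> A j" using b(1)[of j] that A0 by (auto simp: p_def)
    then have "inf_char_fun A \<phi> (fst (p j)) \<le> ereal (\<phi> j)" using that by (intro inf_char_fun_le) auto
    then have "h (fst (p j)) \<le> ereal (\<phi> j)" using h(2) by (meson le_fun_def order_trans)
    then show ?thesis by (simp add: p_def)
  qed
  have "(\<Sum>j=0..CARD('n). w j *\<^sub>R p j) \<in> {(x, t). h x \<le> ereal t}"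
    using w h(1) unfolding prob_simplex_def convex_fun_def
    by (intro convex_sum p) auto
  moreover have "fst (\<Sum>j=0..CARD('n). w j *\<^sub>R p j) = x"
    by (simp add: fst_sum sum.atLeast_Suc_atMost p_def b(2))
  moreover have "snd (\<Sum>j=0..CARD('n). w j *\<^sub>R p j) = (\<Sum>j=1..CARD('n). w j * \<phi> j)"
    by (simp add: snd_sum sum.atLeast_Suc_atMost p_def phi0)
  ultimately show ?thesis by (simp add: case_prod_unfold)
qed

context capra_l0
begin

lemma L0_le_on_support_ball:
  assumes "j \<le> CARD('n)" "x \<in> support_ball N j" shows "L0 N \<phi> x \<le> ereal (\<phi> j)"
  unfolding L0_eq_SUP
proof (rule SUP_least)
  fix y
  show "ereal (x \<bullet> y - g y) \<le> ereal (\<phi> j)"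
    using inner_le_top_dual_norm[OF norm assms(2), of y] top_dual_norm_minus_phi_le_g[OF assms(1), of y] by simp
qed

lemma L0_le_inf_char_fun:
  assumes "\<And>j. A j \<subseteq> support_ball N j" shows "L0 N \<phi> \<le> inf_char_fun A \<phi>"
  unfolding le_fun_def inf_char_fun_eq_Inf
  using assms L0_le_on_support_ball by (auto intro!: Inf_greatest)

lemma convex_L0: "convex_fun (L0 N \<phi>)"
  unfolding L0_eq_SUP by (rule convex_fun_SUP_affine)

lemma lsc_L0: "lsc_fun (L0 N \<phi>)"
  unfolding L0_eq_SUP by (rule lsc_fun_SUP_affine)

lemma L0_le_weighted_sum:
  assumes "w \<in> prob_simplex CARD('n)" "x \<in> weighted_sum w (support_ball N) CARD('n)"
  shows "L0 N \<phi> x \<le> ereal (\<Sum>j=1..CARD('n). w j * \<phi> j)"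
  by (rule convex_fun_le_weighted_sum[OF convex_L0 L0_le_inf_char_fun _ phi_0 assms])
     (auto intro: zero_mem_support_ball norm)

text \<open>The convex hull \<open>C\<close> of the sets \<open>support_ball N j \<times> {\<phi> j}\<close> is compact. If the ray \<open>{x} \<times> {..t}\<close>
missed it, a strictly separating hyperplane with normal \<open>(a, b)\<close> would exist, with \<open>b \<ge> 0\<close> because
the ray goes down. If \<open>b > 0\<close>, dividing by \<open>b\<close> turns the hyperplane into the graph of an affine
minorant of \<open>L0\<close> that exceeds \<open>t\<close> at \<open>x\<close>. A vertical hyperplane is avoided by slightly increasing
\<open>b\<close>: the points of \<open>C\<close> have nonnegative height, so they remain on their side, and the strict gap at
\<open>(x, t)\<close> absorbs the change there.\<close>

lemma L0_le_imp_weighted_sum: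
  assumes t: "L0 N \<phi> x \<le> ereal t"
  obtains w where "w \<in> prob_simplex CARD('n)" "x \<in> weighted_sum w (support_ball N) CARD('n)"
    "(\<Sum>j=1..CARD('n). w j * \<phi> j) \<le> t"
proof -
  define S where "S j = support_ball N j \<times> {\<phi> j}" for j
  define C where "C = convex hull (\<Union>(S ` {0..CARD('n)}))"
  define D where "D = {x} \<times> {..t}"
  have mem_C: "(z, \<phi> j) \<in> C" if "j \<le> CARD('n)" "z \<in> support_ball N j" for z j
    unfolding C_def using that by (intro hull_inc) (auto simp: S_def)
  have "\<not> D \<inter> C = {}"
  proof
    assume disj: "D \<inter> C = {}"
    have "convex D" "closed D" by (auto simp: D_def intro: convex_Times closed_Times)
    moreover have "convex C" "compact C"
      unfolding C_def S_def
      by (auto intro!: compact_convex_hull compact_UN compact_Times compact_support_ball norm)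
    moreover have "C \<noteq> {}" using mem_C[of 0 0] zero_mem_support_ball[OF norm] by auto
    ultimately obtain p \<beta> where p: "\<forall>z\<in>D. p \<bullet> z < \<beta>" "\<forall>z\<in>C. p \<bullet> z > \<beta>"
      using separating_hyperplane_closed_compact[of D C] disj by blast
    obtain a b where ab: "p = (a, b)" by (cases p)
    have below: "a \<bullet> x + b * s < \<beta>" if "s \<le> t" for s
      using p(1) that by (auto simp: D_def ab inner_prod_def)
    have above: "\<beta> < a \<bullet> z + b * \<phi> j" if "j \<le> CARD('n)" "z \<in> support_ball N j" for z j
      using p(2) mem_C[OF that] by (auto simp: ab inner_prod_def)
    have "0 \<le> b"
    proof (rule ccontr)
      assume "\<not> 0 \<le> b"
      \<comment> \<open>A point of the ray low enough to lie on the wrong side of the hyperplane.\<close>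
      then have "\<beta> - a \<bullet> x \<le> b * min t ((\<beta> - a \<bullet> x) / b)"
        using mult_left_mono_neg[of "min t ((\<beta> - a \<bullet> x) / b)" "(\<beta> - a \<bullet> x) / b" b] by simp
      then show False using below[of "min t ((\<beta> - a \<bullet> x) / b)"] by simp
    qed
    define \<delta> where "\<delta> = \<beta> - (a \<bullet> x + b * t)"
    \<comment> \<open>The denominator keeps the increase at height \<open>t\<close> strictly below the gap \<open>\<delta>\<close>.\<close>
    define b' where "b' = b + \<delta> / (\<bar>t\<bar> + 1)"
    have "0 < \<delta>" using below[of t] by (simp add: \<delta>_def)
    then have b': "0 < b'" "b \<le> b'" using \<open>0 \<le> b\<close> by (simp_all add: b'_def add_nonneg_pos)
    have "\<delta> / (\<bar>t\<bar> + 1) * t < \<delta>"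
    proof -
      have "\<delta> * t < \<delta> * (\<bar>t\<bar> + 1)" using \<open>0 < \<delta>\<close> by (intro mult_strict_left_mono) auto
      then show ?thesis by (simp add: pos_divide_less_eq)
    qed
    then have bx: "a \<bullet> x + b' * t < \<beta>" by (simp add: b'_def \<delta>_def algebra_simps)
    define y where "y = (- 1 / b') *\<^sub>R a"
    obtain j where j: "j \<le> CARD('n)" "g y = top_dual_norm N j y - \<phi> j" by (rule g_attained)
    obtain z where z: "z \<in> support_ball N j" "z \<bullet> y = top_dual_norm N j y"
      using top_dual_norm_attained_on_support_ball[OF norm] by blast
    have "b * \<phi> j \<le> b' * \<phi> j" using b'(2) phi_nonneg[OF j(1)] by (rule mult_right_mono)
    then have "a \<bullet> x + b' * t < a \<bullet> z + b' * \<phi> j" using above[OF j(1) z(1)] bx by linarith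
    also have "a \<bullet> x = - b' * (x \<bullet> y)" using b'(1) by (simp add: y_def inner_commute)
    also have "a \<bullet> z = - b' * (z \<bullet> y)" using b'(1) by (simp add: y_def inner_commute)
    finally have "b' * t < b' * (x \<bullet> y - g y)" by (simp add: j(2) z(2) algebra_simps)
    then have "ereal t < ereal (x \<bullet> y - g y)" using b'(1) by simp
    also have "\<dots> \<le> L0 N \<phi> x" by (rule affine_le_L0)
    finally show False using t by simp
  qed
  then obtain s where s: "(x, s) \<in> C" "s \<le> t" by (auto simp: D_def)
  have "C = {\<Sum>j\<in>{0..CARD('n)}. c j *\<^sub>R q j | c q. (\<forall>j\<in>{0..CARD('n)}. 0 \<le> c j) \<and> sum c {0..CARD('n)} = 1
      \<and> (\<forall>j\<in>{0..CARD('n)}. q j \<in> S j)}"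
    unfolding C_def
    by (intro convex_hull_finite_union)
       (use zero_mem_support_ball[OF norm] convex_support_ball[OF norm] in \<open>auto simp: S_def intro: convex_Times\<close>)
  then obtain c q where c: "\<forall>j\<in>{0..CARD('n)}. 0 \<le> c j" "sum c {0..CARD('n)} = 1"
    and q: "\<And>j. j \<in> {0..CARD('n)} \<Longrightarrow> q j \<in> S j"
    and xs: "(x, s) = (\<Sum>j\<in>{0..CARD('n)}. c j *\<^sub>R q j)"
    using s(1) by blast
  define w where "w = restrict c {0..CARD('n)}"
  have q0: "q 0 = (0, 0)" using q[of 0] by (simp add: S_def support_ball_def phi_0)
  have qj: "fst (q j) \<in> support_ball N j" "snd (q j) = \<phi> j" if "j \<in> {1..CARD('n)}" for j
    using q[of j] that by (auto simp: S_def)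
  show ?thesis
  proof
    show "w \<in> prob_simplex CARD('n)" using c by (auto simp: prob_simplex_def w_def)
    have "x = (\<Sum>j=0..CARD('n). c j *\<^sub>R fst (q j))"
      using arg_cong[OF xs, of fst] by (simp add: fst_sum)
    then have "x = (\<Sum>j=1..CARD('n). w j *\<^sub>R fst (q j))"
      by (simp add: sum.atLeast_Suc_atMost q0 w_def)
    then show "x \<in> weighted_sum w (support_ball N) CARD('n)"
      unfolding mem_weighted_sum_iff by (intro exI[of _ "\<lambda>j. fst (q j)"] conjI ballI qj(1))
    have "s = (\<Sum>j=0..CARD('n). c j * snd (q j))"
      using arg_cong[OF xs, of snd] by (simp add: snd_sum)
    then have "s = (\<Sum>j=1..CARD('n). w j * \<phi> j)"
      by (simp add: sum.atLeast_Suc_atMost q0 w_def qj(2))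
    then show "(\<Sum>j=1..CARD('n). w j * \<phi> j) \<le> t" using s(2) by simp
  qed
qed

text \<open>Forget the weights and keep the summands \<open>w j *\<^sub>R b j\<close>: their support dual norms are at most
\<open>w j\<close>, so the cost does not increase.\<close>

lemma weighted_ball_sum_imp_decomposition:
  assumes w: "w \<in> prob_simplex CARD('n)" and x: "x \<in> weighted_sum w (support_ball N) CARD('n)"
  obtains z where "z \<in> {1..CARD('n)} \<rightarrow>\<^sub>E UNIV" "(\<Sum>j=1..CARD('n). support_dual_norm N j (z j)) \<le> 1"
    "(\<Sum>j=1..CARD('n). z j) = x"
    "(\<Sum>j=1..CARD('n). \<phi> j * support_dual_norm N j (z j)) \<le> (\<Sum>j=1..CARD('n). w j * \<phi> j)"
proof -
  obtain b where b: "\<And>j. j \<in> {1..CARD('n)} \<Longrightarrow> b j \<in> support_ball N j" 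
      "x = (\<Sum>j=1..CARD('n). w j *\<^sub>R b j)"
    using x unfolding mem_weighted_sum_iff by blast
  define z where "z = restrict (\<lambda>j. w j *\<^sub>R b j) {1..CARD('n)}"
  have w0: "0 \<le> w j" if "j \<in> {0..CARD('n)}" for j using w that by (auto simp: prob_simplex_def)
  have le: "support_dual_norm N j (z j) \<le> w j" if j: "j \<in> {1..CARD('n)}" for j
  proof -
    have "support_dual_norm N j (b j) \<le> 1" using b(1)[OF j] j by (simp add: support_ball_def)
    then show ?thesis using j w0[of j]
      by (simp add: z_def is_norm_scaleR[OF is_norm_support_dual_norm[OF norm]] mult_left_le)
  qed
  show ?thesis
  proof
    show "z \<in> {1..CARD('n)} \<rightarrow>\<^sub>E UNIV" by (simp add: z_def)
    have "(\<Sum>j=1..CARD('n). support_dual_norm N j (z j)) \<le> (\<Sum>j=1..CARD('n). w j)"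
      by (intro sum_mono le)
    also have "\<dots> \<le> (\<Sum>j=0..CARD('n). w j)" using w0 by (intro sum_mono2) auto
    also have "\<dots> = 1" using w by (simp add: prob_simplex_def)
    finally show "(\<Sum>j=1..CARD('n). support_dual_norm N j (z j)) \<le> 1" .
    show "(\<Sum>j=1..CARD('n). z j) = x" by (simp add: z_def b(2))
    show "(\<Sum>j=1..CARD('n). \<phi> j * support_dual_norm N j (z j)) \<le> (\<Sum>j=1..CARD('n). w j * \<phi> j)"
      by (intro sum_mono) (simp add: mult.commute[of "w _"] mult_left_mono le phi_nonneg)
  qed
qed

text \<open>The support dual norms of the summands serve as new weights, and the slack in their sum becomes
the weight of index \<open>0\<close>. A zero summand gets weight \<open>0\<close> and an arbitrary point of its sphere.\<close>

lemma decomposition_imp_weighted_sphere_sum: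
  assumes z1: "(\<Sum>j=1..CARD('n). support_dual_norm N j (z j)) \<le> 1"
    and zx: "(\<Sum>j=1..CARD('n). z j) = x"
  obtains w where "w \<in> prob_simplex CARD('n)" "x \<in> weighted_sum w (support_sphere N) CARD('n)"
    "(\<Sum>j=1..CARD('n). w j * \<phi> j) = (\<Sum>j=1..CARD('n). \<phi> j * support_dual_norm N j (z j))"
proof -
  define m where "m j = support_dual_norm N j (z j)" for j
  define w where "w = restrict (\<lambda>j. if j = 0 then 1 - (\<Sum>j=1..CARD('n). m j) else m j) {0..CARD('n)}"
  have norm_j: "is_norm (support_dual_norm N j)" if "j \<in> {1..CARD('n)}" for j
    using that by (intro is_norm_support_dual_norm[OF norm]) simp
  have "\<exists>u\<in>support_sphere N j. m j *\<^sub>R u = z j" if j: "j \<in> {1..CARD('n)}" for j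
  proof (cases "z j = 0")
    case True
    obtain u where "u \<in> support_sphere N j" using support_sphere_nonempty[OF norm, of j] j by auto
    then show ?thesis using True is_norm_zero[OF norm_j[OF j]] by (auto simp: m_def)
  next
    case False
    have "(1 / m j) *\<^sub>R z j \<in> support_sphere N j"
      using j is_norm_unit[OF norm_j[OF j] False] by (simp add: support_sphere_def m_def)
    moreover have "m j \<noteq> 0" using False by (simp add: m_def is_norm_eq_0_iff[OF norm_j[OF j]])
    ultimately show ?thesis by (intro bexI[of _ "(1 / m j) *\<^sub>R z j"]) auto
  qed
  then obtain u where u: "\<And>j. j \<in> {1..CARD('n)} \<Longrightarrow> u j \<in> support_sphere N j"
      "\<And>j. j \<in> {1..CARD('n)} \<Longrightarrow> m j *\<^sub>R u j = z j"
    by metis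
  show ?thesis
  proof
    have "sum w {0..CARD('n)} = 1"
      by (simp add: sum.atLeast_Suc_atMost w_def)
    moreover have "0 \<le> w j" if "j \<in> {0..CARD('n)}" for j
      using that z1 is_norm_nonneg[OF norm_j[of j]] by (auto simp: w_def m_def)
    ultimately show "w \<in> prob_simplex CARD('n)" by (auto simp: prob_simplex_def w_def)
    have "x = (\<Sum>j=1..CARD('n). w j *\<^sub>R u j)"
      unfolding zx[symmetric] by (rule sum.cong) (auto simp: w_def u(2))
    then show "x \<in> weighted_sum w (support_sphere N) CARD('n)"
      unfolding mem_weighted_sum_iff using u(1) by blast
    show "(\<Sum>j=1..CARD('n). w j * \<phi> j) = (\<Sum>j=1..CARD('n). \<phi> j * support_dual_norm N j (z j))"
      by (rule sum.cong) (auto simp: w_def m_def)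
  qed
qed

lemma weighted_sum_sphere_subset_ball:
  "weighted_sum w (support_sphere N) CARD('n) \<subseteq> weighted_sum w (support_ball N) CARD('n)"
proof
  fix x assume "x \<in> weighted_sum w (support_sphere N) CARD('n)"
  then show "x \<in> weighted_sum w (support_ball N) CARD('n)"
    using support_sphere_subset_ball[OF norm] unfolding mem_weighted_sum_iff by blast
qed

lemma L0_not_MInf: "L0 N \<phi> x \<noteq> -\<infinity>"
  using L0_nonneg[of x] by auto

lemma L0_le_imp_decomposition:
  assumes t: "L0 N \<phi> x \<le> ereal t"
  obtains z where "z \<in> {1..CARD('n)} \<rightarrow>\<^sub>E UNIV" "(\<Sum>j=1..CARD('n). support_dual_norm N j (z j)) \<le> 1"
    "(\<Sum>j=1..CARD('n). z j) = x"
    "(\<Sum>j=1..CARD('n). \<phi> j * support_dual_norm N j (z j)) \<le> t"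
proof -
  obtain w where w: "w \<in> prob_simplex CARD('n)" "x \<in> weighted_sum w (support_ball N) CARD('n)"
    "(\<Sum>j=1..CARD('n). w j * \<phi> j) \<le> t" using t by (rule L0_le_imp_weighted_sum)
  from w(1,2) show ?thesis
    by (rule weighted_ball_sum_imp_decomposition) (rule that, auto intro: order_trans[OF _ w(3)])
qed

lemma L0_minimum_balls:
  "is_minimum (L0 N \<phi> x) {ereal (\<Sum>j=1..CARD('n). w j * \<phi> j) | w.
     w \<in> prob_simplex CARD('n) \<and> x \<in> weighted_sum w (support_ball N) CARD('n)}"
proof (rule is_minimumI[OF L0_not_MInf], goal_cases)
  case (1 a)
  then show ?case using L0_le_weighted_sum by blast
next
  case (2 t)
  then obtain w where "w \<in> prob_simplex CARD('n)" "x \<in> weighted_sum w (support_ball N) CARD('n)"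
    "(\<Sum>j=1..CARD('n). w j * \<phi> j) \<le> t" by (rule L0_le_imp_weighted_sum)
  then show ?case by (intro bexI[of _ "ereal (\<Sum>j=1..CARD('n). w j * \<phi> j)"]) auto
qed

lemma L0_minimum_spheres:
  "is_minimum (L0 N \<phi> x) {ereal (\<Sum>j=1..CARD('n). w j * \<phi> j) | w.
     w \<in> prob_simplex CARD('n) \<and> x \<in> weighted_sum w (support_sphere N) CARD('n)}"
proof (rule is_minimumI[OF L0_not_MInf], goal_cases)
  case (1 a)
  then show ?case using L0_le_weighted_sum weighted_sum_sphere_subset_ball by blast
next
  case (2 t)
  then obtain z where z: "(\<Sum>j=1..CARD('n). support_dual_norm N j (z j)) \<le> 1"
    "(\<Sum>j=1..CARD('n). z j) = x" "(\<Sum>j=1..CARD('n). \<phi> j * support_dual_norm N j (z j)) \<le> t" 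
    by (rule L0_le_imp_decomposition)
  obtain w where w: "w \<in> prob_simplex CARD('n)" "x \<in> weighted_sum w (support_sphere N) CARD('n)"
    "(\<Sum>j=1..CARD('n). w j * \<phi> j) = (\<Sum>j=1..CARD('n). \<phi> j * support_dual_norm N j (z j))"
    using z(1,2) by (rule decomposition_imp_weighted_sphere_sum)
  have "ereal (\<Sum>j=1..CARD('n). w j * \<phi> j) \<le> ereal t" using w(3) z(3) by simp
  then show ?case using w(1,2) by blast
qed

lemma L0_minimum_decompositions:
  "is_minimum (L0 N \<phi> x)
     {ereal (\<Sum>j=1..CARD('n). \<phi> j * support_dual_norm N j (z j)) | z :: nat \<Rightarrow> real^'n.
       z \<in> {1..CARD('n)} \<rightarrow>\<^sub>E UNIV \<and>
       (\<Sum>j=1..CARD('n). support_dual_norm N j (z j)) \<le> 1 \<and>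
       (\<Sum>j=1..CARD('n). z j) = x}"
proof (rule is_minimumI[OF L0_not_MInf], goal_cases)
  case (1 a)
  then obtain z where z: "(\<Sum>j=1..CARD('n). support_dual_norm N j (z j)) \<le> 1"
    "(\<Sum>j=1..CARD('n). z j) = x" "a = ereal (\<Sum>j=1..CARD('n). \<phi> j * support_dual_norm N j (z j))"
    by blast
  obtain w where "w \<in> prob_simplex CARD('n)" "x \<in> weighted_sum w (support_sphere N) CARD('n)"
    "(\<Sum>j=1..CARD('n). w j * \<phi> j) = (\<Sum>j=1..CARD('n). \<phi> j * support_dual_norm N j (z j))"
    using z(1,2) by (rule decomposition_imp_weighted_sphere_sum)
  then show ?case using L0_le_weighted_sum[of w x] weighted_sum_sphere_subset_ball z(3) by auto
next
  case (2 t)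
  then obtain z where "z \<in> {1..CARD('n)} \<rightarrow>\<^sub>E UNIV" "(\<Sum>j=1..CARD('n). support_dual_norm N j (z j)) \<le> 1"
    "(\<Sum>j=1..CARD('n). z j) = x" "(\<Sum>j=1..CARD('n). \<phi> j * support_dual_norm N j (z j)) \<le> t" 
    by (rule L0_le_imp_decomposition)
  then show ?case
    by (intro bexI[of _ "ereal (\<Sum>j=1..CARD('n). \<phi> j * support_dual_norm N j (z j))"]) auto
qed

text \<open>Balls and spheres are treated alike: Jensen's inequality bounds a convex minorant by every cost
in the variational formula, whose minimum is \<open>L0\<close>.\<close>

lemma L0_largest_convex_lsc_below:
  assumes A: "\<And>j. A j \<subseteq> support_ball N j" "0 \<in> A 0"
    and min: "\<And>x. is_minimum (L0 N \<phi> x) {ereal (\<Sum>j=1..CARD('n). w j * \<phi> j) | w.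
      w \<in> prob_simplex CARD('n) \<and> x \<in> weighted_sum w A CARD('n)}"
  shows "largest_convex_lsc_below (L0 N \<phi>) (inf_char_fun A \<phi>)"
proof -
  have "h x \<le> L0 N \<phi> x" if h: "convex_fun h" "h \<le> inf_char_fun A \<phi>" for h x
  proof -
    have "h x \<le> Inf {ereal (\<Sum>j=1..CARD('n). w j * \<phi> j) | w.
        w \<in> prob_simplex CARD('n) \<and> x \<in> weighted_sum w A CARD('n)}"
      using convex_fun_le_weighted_sum[OF h A(2) phi_0] by (intro Inf_greatest) blast
    then show ?thesis using min[of x] by (simp add: is_minimum_def)
  qed
  then show ?thesis
    using convex_L0 lsc_L0 L0_le_inf_char_fun[OF A(1)]
    unfolding largest_convex_lsc_below_def le_fun_def by blast
qed

lemma inf_char_fun_ball_eq: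
  assumes j: "j \<in> {1..CARD('n)}" and x: "x \<in> support_ball N j - support_ball N (j - 1)"
  shows "inf_char_fun (support_ball N) \<phi> x = ereal (\<phi> j)"
proof (rule antisym)
  show "inf_char_fun (support_ball N) \<phi> x \<le> ereal (\<phi> j)" using j x by (intro inf_char_fun_le) auto
  have "ereal (\<phi> j) \<le> ereal (\<phi> i)" if i: "i \<in> {0..CARD('n)}" "x \<in> support_ball N i" for i
  proof -
    have "\<not> i \<le> j - 1" using x i(2) support_ball_mono[OF norm, of i "j - 1"] by blast
    then have "j \<le> i" by simp
    then show ?thesis using i(1) by (simp add: phi_mono)
  qed
  then show "ereal (\<phi> j) \<le> inf_char_fun (support_ball N) \<phi> x"
    unfolding inf_char_fun_eq_Inf by (intro Inf_greatest) blast
qed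

lemma inf_char_fun_ball_zero: "inf_char_fun (support_ball N) \<phi> 0 = 0"
proof (rule antisym)
  show "inf_char_fun (support_ball N) \<phi> 0 \<le> 0"
    using inf_char_fun_le[of 0 0 "support_ball N" \<phi>] by (simp add: support_ball_def phi_0 zero_ereal_def)
  show "0 \<le> inf_char_fun (support_ball N) \<phi> 0"
    unfolding inf_char_fun_eq_Inf by (intro Inf_greatest) (auto simp: phi_nonneg)
qed

lemma inf_char_fun_ball_outside:
  assumes "x \<notin> support_ball N CARD('n)" shows "inf_char_fun (support_ball N) \<phi> x = \<infinity>"
proof -
  have "{ereal (\<phi> j) | j. j \<in> {0..CARD('n)} \<and> x \<in> support_ball N j} = {}"
    using assms support_ball_mono[OF norm, of _ "CARD('n)"] by auto
  then show ?thesis by (simp only: inf_char_fun_eq_Inf Inf_empty top_ereal_def)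
qed

end

theorem proposition9:
  fixes N :: "real^'n \<Rightarrow> real" and \<phi> :: "nat \<Rightarrow> real"
  assumes "is_norm N"
    and "orthant_strictly_monotonic N"
    and "orthant_strictly_monotonic (dual_norm N)"
    and "\<forall>j\<in>{0..CARD('n)}. 0 \<le> \<phi> j"
    and "mono_on {0..CARD('n)} \<phi>"
    and "\<phi> 0 = 0"
  shows
    \<comment> \<open>(a)\<close>
    "(proper_fun (L0 N \<phi>) \<and> convex_fun (L0 N \<phi>) \<and> lsc_fun (L0 N \<phi>)) \<and>
    \<comment> \<open>(b)\<close>
    (\<forall>s. N s = 1 \<longrightarrow> (ereal \<circ> \<phi> \<circ> l0) s = L0 N \<phi> s) \<and>
    \<comment> \<open>(c)\<close>
    (\<forall>s. N s = 1 \<longrightarrow> capra_subdiff N (ereal \<circ> \<phi> \<circ> l0) s = fenchel_subdiff (L0 N \<phi>) s) \<and>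
    \<comment> \<open>(d)\<close>
    (ereal \<circ> \<phi> \<circ> l0 = L0 N \<phi> \<circ> normalize_by N \<and>
      (\<forall>x. x \<noteq> 0 \<longrightarrow> (ereal \<circ> \<phi> \<circ> l0) x = L0 N \<phi> ((1 / N x) *\<^sub>R x))) \<and>
    \<comment> \<open>(e)\<close>
    (L0 N \<phi> = reverse_fenchel_conj
      (\<lambda>y. SUP j\<in>{0..CARD('n)}. ereal (top_dual_norm N j y - \<phi> j))) \<and>
    \<comment> \<open>(f)\<close>
    (largest_convex_lsc_below (L0 N \<phi>) (inf_char_fun (support_ball N) \<phi>) \<and>
      (\<forall>j\<in>{1..CARD('n)}. \<forall>x \<in> support_ball N j - support_ball N (j - 1).
        inf_char_fun (support_ball N) \<phi> x = ereal (\<phi> j)) \<and>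
      (\<forall>x \<in> support_ball N 0. inf_char_fun (support_ball N) \<phi> x = 0) \<and>
      (\<forall>x. x \<notin> support_ball N CARD('n) \<longrightarrow> inf_char_fun (support_ball N) \<phi> x = \<infinity>) \<and>
      (\<forall>j\<in>{1..CARD('n)}. support_ball N (j - 1) \<subseteq> support_ball N j) \<and>
      support_ball N CARD('n) = {x. N x \<le> 1}) \<and>
    \<comment> \<open>(g)\<close>
    (largest_convex_lsc_below (L0 N \<phi>) (inf_char_fun (support_sphere N) \<phi>) \<and>
      (\<forall>x. inf_char_fun (support_sphere N) \<phi> x =
        Inf {ereal (\<phi> j) | j. j \<in> {0..CARD('n)} \<and> x \<in> support_sphere N j})) \<and>
    \<comment> \<open>(h)\<close>
    (\<forall>x.
      is_minimum (L0 N \<phi> x)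
        {ereal (\<Sum>j=1..CARD('n). w j * \<phi> j) | w.
          w \<in> prob_simplex CARD('n) \<and> x \<in> weighted_sum w (support_ball N) CARD('n)} \<and>
      is_minimum (L0 N \<phi> x)
        {ereal (\<Sum>j=1..CARD('n). w j * \<phi> j) | w.
          w \<in> prob_simplex CARD('n) \<and> x \<in> weighted_sum w (support_sphere N) CARD('n)} \<and>
      is_minimum (L0 N \<phi> x)
        {ereal (\<Sum>j=1..CARD('n). \<phi> j * support_dual_norm N j (z j)) | z :: nat \<Rightarrow> real^'n.
          z \<in> {1..CARD('n)} \<rightarrow>\<^sub>E UNIV \<and>
          (\<Sum>j=1..CARD('n). support_dual_norm N j (z j)) \<le> 1 \<and>
          (\<Sum>j=1..CARD('n). z j) = x})"
proof -
  interpret capra_l0 N \<phi>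
    using assms by unfold_locales (auto simp: mono_on_def)
  have proper: "proper_fun (L0 N \<phi>)"
    unfolding proper_fun_def using L0_not_MInf L0_zero by (metis PInfty_neq_ereal(1) zero_ereal_def)
  have factor: "ereal \<circ> \<phi> \<circ> l0 = L0 N \<phi> \<circ> normalize_by N"
    by (simp add: fun_eq_iff L0_normalize)
  have factor': "(ereal \<circ> \<phi> \<circ> l0) x = L0 N \<phi> ((1 / N x) *\<^sub>R x)" if "x \<noteq> 0" for x
    using L0_normalize[of x] that by (simp add: normalize_by_def)
  have conj: "L0 N \<phi> = reverse_fenchel_conj
      (\<lambda>y. SUP j\<in>{0..CARD('n)}. ereal (top_dual_norm N j y - \<phi> j))"
    by (simp only: L0_def capra_conj_l0 ereal_g_eq_SUP)
  have balls: "largest_convex_lsc_below (L0 N \<phi>) (inf_char_fun (support_ball N) \<phi>)"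
    by (rule L0_largest_convex_lsc_below[OF _ _ L0_minimum_balls]) (auto intro: zero_mem_support_ball norm)
  have spheres: "largest_convex_lsc_below (L0 N \<phi>) (inf_char_fun (support_sphere N) \<phi>)"
    by (rule L0_largest_convex_lsc_below[OF support_sphere_subset_ball[OF norm] _ L0_minimum_spheres])
       (simp add: support_sphere_def)
  have nested: "support_ball N (j - 1) \<subseteq> support_ball N j" for j
    by (rule support_ball_mono[OF norm]) simp
  have ball_0: "inf_char_fun (support_ball N) \<phi> x = 0" if "x \<in> support_ball N 0" for x
    using that inf_char_fun_ball_zero by (simp add: support_ball_def)
  show ?thesis
    by (intro conjI allI impI ballI)
       (fact proper convex_L0 lsc_L0 factor conj balls spheres nested support_ball_card
             L0_minimum_balls L0_minimum_spheres L0_minimum_decompositions inf_char_fun_eq_Inf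
        | rule nested | erule factor' subdiff_L0 inf_char_fun_ball_outside ball_0
        | erule (1) inf_char_fun_ball_eq
        | simp add: L0_unit)+
qed

end
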